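(* Let $m\ge0$, $\gamma=\frac{m+2}{2}$, $\lambda>0$, and let $y_\lambda=y_{\lambda,m}:\mathbb{R}_{\ge0}\to\mathbb{R}_{>0}$ be the function $$y_{\lambda}(t)=C_0\,(\lambda^{\frac1\gamma}t)^{\frac12}\,K_{\frac1{2\gamma}}\!\left(\gamma^{-1}(\lambda^{\frac1\gamma}t)^\gamma\right).$$ Then the following hold, where the constants $T_0(m),T_1(m),C(m)$ depend only on $m$. 1. The functions $y_\lambda$ and $-y_\lambda'$ are decreasing on $[0,\infty)$, and $\lim_{t\to\infty}y_\lambda'(t)=\lim_{t\to\infty}y_\lambda(t)=0$. 2. There exist $T_0=T_0(m)\ge1$ and $C=C(m)>1$ such that for every $t\ge0$ with $\lambda t^\gamma\ge T_0$, $$C^{-1}(\lambda^{\frac1\gamma}t)^{-\frac m4}\exp\left(-\gamma^{-1}(\lambda^{\frac1\gamma}t)^\gamma\right)\le y_\lambda(t)\le C(\lambda^{\frac1\gamma}t)^{-\frac m4}\exp\left(-\gamma^{-1}(\lambda^{\frac1\gamma}t)^\gamma\right).$$ 3. There exists $C=C(m)>1$ such that for every $t\ge0$ with $\lambda^{\frac1\gamma}t\ge1$, $$C^{-1}t^{\frac m2}\lambda\,y_\lambda(t)\le|\partial_ty_\lambda(t)|\le C\,t^{\frac m2}\lambda\,y_\lambda(t).$$ Moreover, there exist $T_1=T_1(m)>1$ and $C=C(m)>1$ such that for every $t\ge0$ with $\lambda^{\frac1\gamma}t\ge T_1$, $$C^{-1}\lambda^{\frac12+\frac1{m+2}}t^{\frac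 m4}\exp\left(-\gamma^{-1}(\lambda^{\frac1\gamma}t)^\gamma\right)\le|\partial_ty_\lambda(t)|\le C\lambda^{\frac12+\frac1{m+2}}t^{\frac m4}\exp\left(-\gamma^{-1}(\lambda^{\frac1\gamma}t)^\gamma\right).$$
   Context: For $\nu>0$, $K_\nu$ is the modified Bessel function of the second kind, $K_\nu(t):=\int_0^\infty e^{-t\cosh z}\cosh(\nu z)\,dz$. The constant is $C_0=C_0(\gamma):=\gamma^{-\frac1{2\gamma}}\,2^{1-\frac1{2\gamma}}\,\Gamma\!\left(\frac1{2\gamma}\right)^{-1}$ with $\Gamma$ the Gamma function; it is chosen so that $\lim_{t\to+0}y_\lambda(t)=1$, and values of $y_\lambda$ and $y_\lambda'$ at $t=0$ are understood as limits $t\to+0$. The function $y_\lambda$ is a solution of the ordinary differential equation $y''-\lambda^2t^my=0$ for $t\ge0$. *)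

theory Defs
  imports "HOL-Analysis.Analysis"
begin

text \<open>
  The modified Bessel function of the second kind, as a Lebesgue integral.  The integrand is
  nonnegative and the integral converges whenever \<open>t > 0\<close>.
\<close>

definition bessel_K :: "real \<Rightarrow> real \<Rightarrow> real" where
  "bessel_K \<nu> t = (LBINT z:{0..}. exp (- t * cosh z) * cosh (\<nu> * z))"

definition C0 :: "real \<Rightarrow> real" where
  "C0 \<gamma> = \<gamma> powr (- (1 / (2 * \<gamma>))) * 2 powr (1 - 1 / (2 * \<gamma>)) * inverse (Gamma (1 / (2 * \<gamma>)))"

definition y_formula :: "real \<Rightarrow> real \<Rightarrow> real \<Rightarrow> real" where
  "y_formula m lam t =
     (let \<gamma> = (m + 2) / 2 in
        C0 \<gamma> * (lam powr (1 / \<gamma>) * t) powr (1 / 2)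
          * bessel_K (1 / (2 * \<gamma>)) ((lam powr (1 / \<gamma>) * t) powr \<gamma> / \<gamma>))"

text \<open>
  At \<open>t = 0\<close> the formula is the meaningless product of \<open>0\<close> and \<open>K\<^sub>\<nu>(0)\<close> (a divergent integral, which
  HOL evaluates to \<open>0\<close>), so the values of the function and of its derivative at \<open>0\<close> are the limits
  as \<open>t\<close> tends to \<open>0\<close> from the right.  Values at negative \<open>t\<close> are irrelevant; in particular
  \<open>deriv\<close> below is taken only at points \<open>t > 0\<close> with a neighbourhood on which \<open>y_sol\<close>
  is given by the formula.
\<close>

definition y_sol :: "real \<Rightarrow> real \<Rightarrow> real \<Rightarrow> real" where
  "y_sol m lam t = (if t = 0 then Lim (at_right 0) (y_formula m lam) else y_formula m lam t)"

definition y_deriv :: "real \<Rightarrow> real \<Rightarrow> real \<Rightarrow> real" where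
  "y_deriv m lam t =
     (if t = 0 then Lim (at_right 0) (deriv (y_sol m lam)) else deriv (y_sol m lam) t)"

end

theory Submission
  imports Defs
begin

text \<open>
  Writing \<open>\<mu> = \<lambda>\<^bsup>1/\<gamma>\<^esup>\<close>, we have \<open>y\<^sub>\<lambda>(t) = Y(\<mu> t)\<close> for the solution
  \<open>Y = y\<^sub>1\<close> of \<open>Y'' = s\<^sup>m Y\<close>, so it suffices to study \<open>Y\<close>.  The equation comes from
  differentiating the integral for \<open>K\<^sub>\<nu>\<close> and integrating a total derivative.  The monotonicity and limit
  claims use only that \<open>Y\<close> is a positive solution tending to \<open>0\<close>: it is convex, hence
  decreasing, and a Gronwall estimate bounds \<open>Y\<close> and \<open>Y'\<close> near \<open>0\<close>.  The size of \<open>Y\<close> follows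
  from elementary two-sided bounds for \<open>K\<^sub>\<nu>\<close>, where \<open>\<nu> \<le> 1/2\<close> matters.  Finally
  \<open>|Y'| \<ge> s\<^bsup>m/2\<^esup> Y\<close> is an energy inequality, while the opposite bound for \<open>s \<ge> 1\<close> holds
  because \<open>K\<^sub>\<nu>\<close> is log-convex, so that \<open>- K\<^sub>\<nu>' / K\<^sub>\<nu>\<close> is nonincreasing.
\<close>

section \<open>Moments of the Bessel integral\<close>

text \<open>Up to the sign (-1)^k this is the k-th derivative of \<open>bessel_K \<nu>\<close> at x
  > 0 (see \<open>bessel_moment_deriv\<close>), so one integrability lemma and one differentiation
  lemma serve every order.\<close>

definition bessel_moment :: "real \<Rightarrow> nat \<Rightarrow> real \<Rightarrow> real" where
  "bessel_moment \<nu> k x = (LBINT z:{0..}. cosh z ^ k * (exp (- x * cosh z) * cosh (\<nu> * z)))"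

lemma bessel_K_eq_moment: "bessel_K \<nu> x = bessel_moment \<nu> 0 x"
  by (simp add: bessel_K_def bessel_moment_def)

section \<open>Convergence and positivity of the moments\<close>

lemma power_le_fact_exp:
  fixes y :: real
  assumes "y \<ge> 0"
  shows "y ^ n \<le> fact n * exp y"
proof -
  have "(\<Sum>k\<in>{n}. y ^ k /\<^sub>R fact k) \<le> (\<Sum>k. y ^ k /\<^sub>R fact k)"
    by (rule sum_le_suminf[OF summable_exp_generic]) (use assms in auto)
  then show ?thesis
    by (simp add: exp_def field_simps)
qed

text \<open>Since exp z \<le> 2 cosh z, multiplying by exp z costs one more power of cosh, and
  u^(k+1) \<le> (k+1)! exp u at u = x cosh z absorbs all of them.\<close>

lemma cosh_power_exp_le:
  fixes x z :: real
  assumes "x > 0"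
  shows "cosh z ^ k * exp (- x * cosh z) \<le> 2 * fact (Suc k) / x ^ Suc k * exp (- z)"
proof -
  have "exp z * (cosh z ^ k * exp (- x * cosh z)) \<le> (2 * cosh z) * (cosh z ^ k * exp (- x * cosh z))"
    by (intro mult_right_mono) (auto simp: cosh_field_def)
  also have "\<dots> = 2 * (x * cosh z) ^ Suc k / exp (x * cosh z) / x ^ Suc k"
    using assms by (simp add: exp_minus field_simps power_mult_distrib)
  also have "\<dots> \<le> 2 * fact (Suc k) / x ^ Suc k"
    using power_le_fact_exp[of "x * cosh z" "Suc k"] assms
    by (intro divide_right_mono) (auto simp: field_simps simp del: fact_Suc power_Suc)
  finally have "exp z * (cosh z ^ k * exp (- x * cosh z)) \<le> 2 * fact (Suc k) / x ^ Suc k" .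
  then have "exp (- z) * (exp z * (cosh z ^ k * exp (- x * cosh z)))
      \<le> exp (- z) * (2 * fact (Suc k) / x ^ Suc k)"
    by (rule mult_left_mono) simp
  then show ?thesis
    by (simp add: mult.assoc[symmetric] exp_minus del: fact_Suc power_Suc) (simp add: ac_simps)
qed

lemma cosh_real_mono_abs:
  fixes x y :: real
  assumes "\<bar>x\<bar> \<le> \<bar>y\<bar>"
  shows "cosh x \<le> cosh y"
  using cosh_real_nonneg_le_iff[of "\<bar>x\<bar>" "\<bar>y\<bar>"] assms by (simp add: abs_if split: if_splits)

lemma cosh_mult_le:
  fixes a z :: real
  assumes "\<bar>a\<bar> \<le> 1"
  shows "cosh (a * z) \<le> cosh z"
  by (rule cosh_real_mono_abs) (use assms in \<open>simp add: abs_mult mult_left_le_one_le\<close>)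

lemma set_integrable_exp_minus_atLeast: "set_integrable lborel {0..} (\<lambda>z::real. exp (- z))"
proof -
  have "(\<integral>\<^sup>+z. ennreal (exp (- z)) * indicator {0..} z \<partial>lborel) = ennreal (0 - (- exp (- 0)))"
  proof (rule nn_integral_FTC_atLeast)
    show "((\<lambda>z::real. - exp (- z)) \<longlongrightarrow> 0) at_top"
      by (rule tendsto_eq_intros filterlim_compose[OF exp_at_bot] filterlim_uminus_at_bot_at_top | simp)+
  qed (auto intro!: derivative_eq_intros)
  then have "(\<integral>\<^sup>+z. ennreal (norm (indicator {0..} z *\<^sub>R exp (- z :: real))) \<partial>lborel) < \<infinity>"
    by (subst nn_integral_cong[where v = "\<lambda>z. ennreal (exp (- z)) * indicator {0..} z"])
       (auto split: split_indicator)
  then show ?thesis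
    unfolding set_integrable_def by (intro integrableI_bounded) auto
qed

lemma bessel_moment_integrable:
  fixes \<nu> x :: real
  assumes "\<bar>\<nu>\<bar> \<le> 1" "x > 0"
  shows "set_integrable lborel {0..} (\<lambda>z. cosh z ^ k * (exp (- x * cosh z) * cosh (\<nu> * z)))"
proof (rule set_integrable_bound)
  \<comment> \<open>Of the two extra powers, one pays for cosh (\<nu> z) \<le> cosh z and the other
    for the factor exp (- z) in \<open>cosh_power_exp_le\<close>.\<close>
  let ?c = "2 * fact (Suc (Suc k)) / x ^ Suc (Suc k)"
  show "set_integrable lborel {0..} (\<lambda>z. ?c * exp (- z))"
    by (intro set_integrable_mult_right set_integrable_exp_minus_atLeast)
  show "set_borel_measurable lborel {0..} (\<lambda>z. cosh z ^ k * (exp (- x * cosh z) * cosh (\<nu> * z)))"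
  proof -
    have "(\<lambda>z. cosh z ^ k * (exp (- x * cosh z) * cosh (\<nu> * z))) \<in> borel_measurable borel"
      by (intro borel_measurable_continuous_onI continuous_intros)
    then show ?thesis unfolding set_borel_measurable_def by simp
  qed
  have "cosh z ^ k * (exp (- x * cosh z) * cosh (\<nu> * z)) \<le> ?c * exp (- z)" for z
  proof -
    have "cosh z ^ k * (exp (- x * cosh z) * cosh (\<nu> * z)) \<le> cosh z ^ k * (exp (- x * cosh z) * cosh z)"
      using cosh_mult_le[OF assms(1)] by (intro mult_left_mono) auto
    also have "\<dots> = cosh z ^ Suc k * exp (- x * cosh z)" by simp
    finally show ?thesis using cosh_power_exp_le[OF assms(2), of z "Suc k"] by linarith
  qed
  then show "AE z in lborel. z \<in> {0..} \<longrightarrow>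
      norm (cosh z ^ k * (exp (- x * cosh z) * cosh (\<nu> * z))) \<le> norm (?c * exp (- z))"
    using assms by (simp add: abs_mult)
qed

text \<open>Only the integral over [0, a] is kept, where exp (- x cosh z) is smallest at a and the
  other factors are at least 1. Positivity uses a = 1, the sharp lower bound a = 1 / sqrt x.\<close>

lemma bessel_moment_lower:
  assumes "\<bar>\<nu>\<bar> \<le> 1" "x > 0" "a \<ge> 0"
  shows "a * exp (- x * cosh a) \<le> bessel_moment \<nu> k x"
proof -
  have "(\<integral>z. indicator {0..a} z *\<^sub>R exp (- x * cosh a) \<partial>lborel) \<le> bessel_moment \<nu> k x"
    unfolding bessel_moment_def set_lebesgue_integral_def
  proof (rule integral_mono)
    show "integrable lborel (\<lambda>z. indicat_real {0..a} z *\<^sub>R exp (- x * cosh a))"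
      using assms by simp
    show "integrable lborel (\<lambda>z. indicat_real {0..} z *\<^sub>R (cosh z ^ k * (exp (- x * cosh z) * cosh (\<nu> * z))))"
      using bessel_moment_integrable[OF assms(1,2)] by (simp add: set_integrable_def)
    show "indicat_real {0..a} z *\<^sub>R exp (- x * cosh a)
        \<le> indicat_real {0..} z *\<^sub>R (cosh z ^ k * (exp (- x * cosh z) * cosh (\<nu> * z)))" for z
    proof (cases "z \<in> {0..a}")
      case True
      have "exp (- x * cosh a) \<le> exp (- x * cosh z)"
        using True assms by (auto intro!: cosh_real_mono_abs)
      also have "\<dots> \<le> exp (- x * cosh z) * cosh (\<nu> * z)"
        using cosh_real_ge_1[of "\<nu> * z"] by simp
      also have "\<dots> \<le> cosh z ^ k * (exp (- x * cosh z) * cosh (\<nu> * z))"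
        using one_le_power[OF cosh_real_ge_1[of z], of k] by simp
      finally show ?thesis using True by simp
    qed (auto simp: indicator_def)
  qed
  then show ?thesis using assms by simp
qed

lemma bessel_moment_pos:
  assumes "\<bar>\<nu>\<bar> \<le> 1" "x > 0"
  shows "bessel_moment \<nu> k x > 0"
  by (rule less_le_trans[OF _ bessel_moment_lower[OF assms, of 1]]) auto

section \<open>Differentiation under the integral sign and the Bessel equation\<close>

text \<open>From 1 - u \<le> exp (- u) follows exp u - 1 - u \<le> u (exp u - 1) for either sign of
  u. The bracket is at most u exp u if u is nonnegative, and at least u if u is negative.\<close>

lemma exp_minus_taylor1_bounds:
  fixes u :: real
  shows "0 \<le> exp u - 1 - u" "exp u - 1 - u \<le> u\<^sup>2 * exp \<bar>u\<bar>"
proof -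
  show "0 \<le> exp u - 1 - u" using exp_ge_add_one_self[of u] by linarith
  have "(1 + (- u)) * exp u \<le> exp (- u) * exp u"
    by (intro mult_right_mono exp_ge_add_one_self) simp
  then have *: "exp u - 1 \<le> u * exp u" by (simp add: algebra_simps flip: exp_add)
  show "exp u - 1 - u \<le> u\<^sup>2 * exp \<bar>u\<bar>"
  proof (cases "u \<ge> 0")
    case True
    then have "u * (exp u - 1) \<le> u * (u * exp u)" using * by (intro mult_left_mono)
    then show ?thesis using * True by (simp add: power2_eq_square algebra_simps)
  next
    case False
    then have "u * (exp u - 1) \<le> u * u"
      using exp_ge_add_one_self[of u] by (intro mult_left_mono_neg) linarith+
    moreover have "u\<^sup>2 * 1 \<le> u\<^sup>2 * exp \<bar>u\<bar>" by (intro mult_left_mono) auto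
    ultimately show ?thesis using * by (simp add: power2_eq_square algebra_simps)
  qed
qed

text \<open>A quadratic remainder leaves an error of at most B |h| in the difference quotient. Thus
  a parameter integral can be differentiated from a pointwise Taylor estimate of its
  integrand.\<close>

lemma DERIV_from_quadratic_bound:
  fixes f :: "real \<Rightarrow> real"
  assumes "r > 0" and "\<And>h. \<bar>h\<bar> < r \<Longrightarrow> \<bar>f (x + h) - f x - D * h\<bar> \<le> B * h\<^sup>2"
  shows "(f has_real_derivative D) (at x)"
proof -
  have "((\<lambda>h. (f (x + h) - f x) / h - D) \<longlongrightarrow> 0) (at 0)"
  proof (rule Lim_null_comparison)
    show "((\<lambda>h. B * \<bar>h\<bar>) \<longlongrightarrow> 0) (at 0)"
      by (rule tendsto_eq_intros | simp)+
    have "\<forall>\<^sub>F h in at 0. h \<noteq> 0 \<and> \<bar>h\<bar> < r"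
      using \<open>r > 0\<close> by (auto simp: eventually_at intro!: exI[of _ r])
    then show "\<forall>\<^sub>F h in at 0. norm ((f (x + h) - f x) / h - D) \<le> B * \<bar>h\<bar>"
    proof eventually_elim
      case (elim h)
      have "(f (x + h) - f x) / h - D = (f (x + h) - f x - D * h) / h"
        using elim by (simp add: field_simps)
      moreover have "B * h\<^sup>2 / \<bar>h\<bar> = B * \<bar>h\<bar>"
        using elim by (simp add: power2_eq_square abs_if)
      ultimately show ?case
        using divide_right_mono[OF assms(2)[of h], of "\<bar>h\<bar>"] elim by simp
    qed
  qed
  then show ?thesis by (simp add: DERIV_def LIM_zero_iff)
qed

text \<open>The Taylor remainder of the integrand is at most h^2 times the integrand of order k + 2
  at x / 2: as |h| < x / 2, half of the exponent - x cosh z absorbs exp (|h| cosh z).\<close>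

lemma bessel_moment_deriv:
  assumes "\<bar>\<nu>\<bar> \<le> 1" "x > 0"
  shows "(bessel_moment \<nu> k has_real_derivative - bessel_moment \<nu> (Suc k) x) (at x)"
proof (rule DERIV_from_quadratic_bound)
  show "x / 2 > 0" using assms by simp
  fix h :: real assume h: "\<bar>h\<bar> < x / 2"
  define t where "t = (\<lambda>k y z. cosh z ^ k * (exp (- y * cosh z) * cosh (\<nu> * z)))"
  have int: "set_integrable lborel {0..} (t k y)" if "y > 0" for k y
    unfolding t_def using that assms by (intro bessel_moment_integrable)
  have M: "bessel_moment \<nu> k y = (LBINT z:{0..}. t k y z)" for k y
    by (simp add: bessel_moment_def t_def)
  define d where "d = (\<lambda>z. t k (x + h) z - t k x z + h * t (Suc k) x z)"
  have pos: "x + h > 0" "x / 2 > 0" using h assms by auto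
  have int_d: "set_integrable lborel {0..} d"
    unfolding d_def using int pos assms by (intro set_integral_add set_integral_diff set_integrable_mult_right)
  have d_bounds: "0 \<le> d z \<and> d z \<le> h\<^sup>2 * t (k + 2) (x / 2) z" for z
  proof -
    define c where "c = cosh z"
    have c: "c > 0" by (simp add: c_def)
    define w where "w = c ^ k * (exp (- x * c) * cosh (\<nu> * z))"
    have w: "w \<ge> 0" unfolding w_def c_def by simp
    have "d z = w * (exp (- h * c) - 1 - (- h * c))"
      by (simp add: d_def t_def w_def c_def exp_add algebra_simps exp_diff exp_minus)
    moreover have "w * (exp (- h * c) - 1 - (- h * c)) \<le> w * ((- h * c)\<^sup>2 * exp \<bar>- h * c\<bar>)"
      by (intro mult_left_mono exp_minus_taylor1_bounds w)
    moreover have "w * ((- h * c)\<^sup>2 * exp \<bar>- h * c\<bar>) \<le> w * ((- h * c)\<^sup>2 * exp (x / 2 * c))"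
      using h c w by (intro mult_left_mono) (auto simp: abs_mult)
    moreover have "w * ((- h * c)\<^sup>2 * exp (x / 2 * c)) = h\<^sup>2 * t (k + 2) (x / 2) z"
    proof -
      have e: "exp (- (x / 2) * c) = exp (- x * c) * exp (x / 2 * c)"
        by (simp flip: exp_add)
      show ?thesis
        unfolding w_def t_def c_def[symmetric] power_add e
        by (simp add: power2_eq_square algebra_simps)
    qed
    ultimately show ?thesis
      using w exp_minus_taylor1_bounds(1)[of "- h * c"] by (auto intro!: mult_nonneg_nonneg)
  qed
  have "bessel_moment \<nu> k (x + h) - bessel_moment \<nu> k x - (- bessel_moment \<nu> (Suc k) x) * h
      = (LBINT z:{0..}. d z)"
    unfolding M d_def using int pos assms
    by (simp add: set_integral_add set_integral_diff)
  moreover have "0 \<le> (LBINT z:{0..}. d z)"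
    using d_bounds by (auto simp: set_lebesgue_integral_def intro!: integral_nonneg_AE)
  moreover have "(LBINT z:{0..}. d z) \<le> (LBINT z:{0..}. h\<^sup>2 * t (k + 2) (x / 2) z)"
    using d_bounds int pos by (intro set_integral_mono int_d set_integrable_mult_right) auto
  ultimately show "\<bar>bessel_moment \<nu> k (x + h) - bessel_moment \<nu> k x - (- bessel_moment \<nu> (Suc k) x) * h\<bar>
      \<le> bessel_moment \<nu> (k + 2) (x / 2) * h\<^sup>2"
    by (simp add: M mult.commute)
qed

text \<open>The combination of integrands is the derivative of \<open>F\<close> below, which vanishes at \<open>0\<close> and at \<open>\<infinity>\<close>.\<close>

lemma bessel_moment_recurrence:
  assumes "\<bar>\<nu>\<bar> \<le> 1" "x > 0"
  shows "x\<^sup>2 * bessel_moment \<nu> 2 x - x * bessel_moment \<nu> 1 x - (x\<^sup>2 + \<nu>\<^sup>2) * bessel_moment \<nu> 0 x = 0"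
proof -
  define t where "t = (\<lambda>k z. cosh z ^ k * (exp (- x * cosh z) * cosh (\<nu> * z)))"
  have int: "set_integrable lborel {0..} (t k)" for k
    unfolding t_def using assms by (intro bessel_moment_integrable)
  have M: "bessel_moment \<nu> k x = (LBINT z:{0..}. t k z)" for k
    by (simp add: bessel_moment_def t_def)
  define f where "f = (\<lambda>z. x\<^sup>2 * t 2 z - x * t 1 z - (x\<^sup>2 + \<nu>\<^sup>2) * t 0 z)"
  \<comment> \<open>\<open>F\<close> is the Wronskian in z of exp (- x cosh z) and cosh (\<nu> z),
    whose second derivatives are x^2 sinh^2 z - x cosh z and \<nu>^2 times the functions themselves.
    The resulting identity is the modified Bessel equation.\<close>
  define F where "F = (\<lambda>z. - exp (- x * cosh z) * (x * sinh z * cosh (\<nu> * z) + \<nu> * sinh (\<nu> * z)))"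
  have int_f: "set_integrable lborel {0..} f"
    unfolding f_def by (intro set_integral_diff set_integrable_mult_right int)
  have F_deriv: "(F has_real_derivative f z) (at z)" for z
  proof -
    have "(F has_real_derivative
        exp (- x * cosh z) * cosh (\<nu> * z) * (x\<^sup>2 * (sinh z)\<^sup>2 - x * cosh z - \<nu>\<^sup>2)) (at z)"
      unfolding F_def
      by (auto intro!: derivative_eq_intros simp: power2_eq_square algebra_simps)
    also have "exp (- x * cosh z) * cosh (\<nu> * z) * (x\<^sup>2 * (sinh z)\<^sup>2 - x * cosh z - \<nu>\<^sup>2) = f z"
      unfolding sinh_square_eq f_def t_def by (simp add: algebra_simps)
    finally show ?thesis .
  qed
  have "(LBINT z:{0..b}. f z) = F b - F 0" if "b \<ge> 0" for b
    unfolding set_lebesgue_integral_def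
  proof (rule integral_FTC_atLeastAtMost[OF that])
    show "(F has_vector_derivative f z) (at z within {0..b})" for z
      using F_deriv by (auto simp: has_real_derivative_iff_has_vector_derivative
          intro: has_vector_derivative_at_within)
    show "continuous_on {0..b} f"
      unfolding f_def t_def by (intro continuous_intros)
  qed
  then have "\<forall>\<^sub>F b in at_top. (LBINT z:{0..b}. f z) = F b"
    by (intro eventually_mono[OF eventually_ge_at_top[of 0]]) (simp add: F_def)
  moreover have "(F \<longlongrightarrow> 0) at_top"
  proof (rule Lim_null_comparison)
    \<comment> \<open>The two terms of the bracket in \<open>F\<close> are bounded by x cosh^2 b and
      cosh^2 b; the rest is \<open>cosh_power_exp_le\<close> with k = 2.\<close>
    let ?C = "(x + 1) * (2 * fact (Suc 2) / x ^ Suc 2)"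
    show "((\<lambda>b. ?C * exp (- b)) \<longlongrightarrow> 0) at_top"
      by (rule tendsto_eq_intros filterlim_compose[OF exp_at_bot] filterlim_uminus_at_bot_at_top | simp)+
    have "norm (F b) \<le> ?C * exp (- b)" for b
    proof -
      have abs_sinh: "\<bar>sinh u\<bar> \<le> cosh u" for u :: real
        by (auto simp: sinh_def cosh_def abs_le_iff)
      have "\<bar>x * sinh b * cosh (\<nu> * b) + \<nu> * sinh (\<nu> * b)\<bar>
          \<le> \<bar>x * sinh b * cosh (\<nu> * b)\<bar> + \<bar>\<nu> * sinh (\<nu> * b)\<bar>"
        by (rule abs_triangle_ineq)
      also have "\<bar>x * sinh b * cosh (\<nu> * b)\<bar> \<le> x * cosh b * cosh b"
        using assms abs_sinh[of b] cosh_mult_le[OF assms(1), of b]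
        by (auto simp: abs_mult intro!: mult_mono)
      also have "\<bar>\<nu> * sinh (\<nu> * b)\<bar> \<le> 1 * cosh b"
        unfolding abs_mult using assms abs_sinh[of "\<nu> * b"] cosh_mult_le[OF assms(1), of b]
        by (intro mult_mono) auto
      also have "1 * cosh b \<le> cosh b * cosh b"
        using cosh_real_ge_1[of b] by (intro mult_right_mono) auto
      finally have "\<bar>x * sinh b * cosh (\<nu> * b) + \<nu> * sinh (\<nu> * b)\<bar> \<le> (x + 1) * cosh b ^ 2"
        by (simp add: power2_eq_square algebra_simps)
      then have "norm (F b) \<le> (x + 1) * (cosh b ^ 2 * exp (- x * cosh b))"
        unfolding F_def by (simp add: abs_mult)
      also have "\<dots> \<le> (x + 1) * (2 * fact (Suc 2) / x ^ Suc 2 * exp (- b))"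
        using assms by (intro mult_left_mono cosh_power_exp_le) auto
      finally show ?thesis by (simp only: mult.assoc)
    qed
    then show "\<forall>\<^sub>F b in at_top. norm (F b) \<le> ?C * exp (- b)" by simp
  qed
  ultimately have "((\<lambda>b. LBINT z:{0..b}. f z) \<longlongrightarrow> 0) at_top"
    by (simp add: filterlim_cong)
  moreover have "((\<lambda>b. LBINT z:{0..b}. f z) \<longlongrightarrow> (LBINT z:{0..}. f z)) at_top"
    using int_f by (intro tendsto_set_lebesgue_integral_at_top) auto
  ultimately have "(LBINT z:{0..}. f z) = 0"
    using tendsto_unique trivial_limit_at_top_linorder by blast
  moreover have "(LBINT z:{0..}. f z) = x\<^sup>2 * bessel_moment \<nu> 2 x - x * bessel_moment \<nu> 1 x
      - (x\<^sup>2 + \<nu>\<^sup>2) * bessel_moment \<nu> 0 x"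
    unfolding f_def M using int by simp
  ultimately show ?thesis by simp
qed

section \<open>Two-sided bounds for the moment of order 0\<close>

text \<open>
  Since \<open>cosh z = 1 + 2 sinh\<^sup>2 (z/2)\<close> and \<open>exp (- u) \<le> 1 / (1 + u)\<close>, the integrand is at most the
  derivative of a multiple of \<open>arctan (sqrt (2 x) sinh (z/2))\<close>.
\<close>

lemma bessel_moment_0_upper:
  assumes "\<bar>\<nu>\<bar> \<le> 1 / 2" "x > 0"
  shows "bessel_moment \<nu> 0 x \<le> pi / sqrt (2 * x) * exp (- x)"
proof (rule tendsto_upperbound)
  define t where "t = (\<lambda>z. exp (- x * cosh z) * cosh (\<nu> * z))"
  define g where "g = (\<lambda>z. exp (- x) * (cosh (z / 2) / (1 + 2 * x * (sinh (z / 2))\<^sup>2)))"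
  define G where "G = (\<lambda>z. exp (- x) * (2 / sqrt (2 * x) * arctan (sqrt (2 * x) * sinh (z / 2))))"
  have int: "set_integrable lborel {0..} t"
    unfolding t_def using bessel_moment_integrable[of \<nu> x 0] assms by simp
  then show "((\<lambda>b. LBINT z:{0..b}. t z) \<longlongrightarrow> bessel_moment \<nu> 0 x) at_top"
    unfolding bessel_moment_def t_def by simp (intro tendsto_set_lebesgue_integral_at_top, auto)
  have den: "1 + 2 * x * (sinh (z / 2))\<^sup>2 > 0" for z
    using assms by (intro add_pos_nonneg) auto
  have G_deriv: "(G has_real_derivative g z) (at z)" for z
  proof -
    define r where "r = sqrt (2 * x)"
    have r: "r > 0" "2 * x = r\<^sup>2" using assms by (auto simp: r_def)
    have "(G has_real_derivative
        exp (- x) * (2 / r * (inverse (1 + (r * sinh (z / 2))\<^sup>2) * (r * (cosh (z / 2) * (1 / 2)))))) (at z)"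
      unfolding G_def r_def[symmetric]
      by (rule DERIV_cmult, rule DERIV_cmult, rule DERIV_chain2[OF DERIV_arctan], rule DERIV_cmult)
         (auto intro!: derivative_eq_intros)
    moreover have "exp (- x) * (2 / r * (inverse (1 + (r * sinh (z / 2))\<^sup>2) * (r * (cosh (z / 2) * (1 / 2)))))
        = exp (- x) * (cosh (z / 2) * inverse (1 + (r * sinh (z / 2))\<^sup>2))"
      using r(1) by simp
    moreover have "exp (- x) * (cosh (z / 2) * inverse (1 + (r * sinh (z / 2))\<^sup>2)) = g z"
      by (simp only: g_def r(2) power_mult_distrib divide_inverse[of "cosh (z / 2)"])
    ultimately show ?thesis by simp
  qed
  have g_cont: "continuous_on {0..b} g" for b
    unfolding g_def using den by (intro continuous_intros) (auto simp: less_imp_neq[symmetric])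
  have t_le: "t z \<le> g z" for z
  proof -
    have "cosh z = 1 + 2 * (sinh (z / 2))\<^sup>2"
      using cosh_double[of "z / 2"] cosh_square_eq[of "z / 2"] by simp
    then have "exp (- x * cosh z) = exp (- x) * inverse (exp (2 * x * (sinh (z / 2))\<^sup>2))"
      by (simp add: algebra_simps flip: exp_minus exp_add)
    moreover have "inverse (exp (2 * x * (sinh (z / 2))\<^sup>2)) \<le> inverse (1 + 2 * x * (sinh (z / 2))\<^sup>2)"
      using den by (intro le_imp_inverse_le exp_ge_add_one_self)
    \<comment> \<open>Here |\<nu>| \<le> 1/2 enters: cosh (z / 2) is twice the derivative of sinh (z
      / 2), which is what the arctan primitive needs.\<close>
    moreover have "cosh (\<nu> * z) \<le> cosh (z / 2)"
      using cosh_mult_le[of "2 * \<nu>" "z / 2"] assms by (simp add: abs_mult)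
    ultimately have "t z \<le> exp (- x) * inverse (1 + 2 * x * (sinh (z / 2))\<^sup>2) * cosh (z / 2)"
      unfolding t_def using den[of z] by (simp add: mult_mono)
    then show ?thesis by (simp add: g_def field_simps)
  qed
  have "(LBINT z:{0..b}. t z) \<le> pi / sqrt (2 * x) * exp (- x)" if "b \<ge> 0" for b
  proof -
    have "(LBINT z:{0..b}. t z) \<le> (LBINT z:{0..b}. g z)"
      using t_le by (intro set_integral_mono set_integrable_subset[OF int] borel_integrable_atLeastAtMost'
          g_cont) auto
    also have "\<dots> = G b - G 0"
      unfolding set_lebesgue_integral_def
    proof (rule integral_FTC_atLeastAtMost[OF that])
      show "(G has_vector_derivative g z) (at z within {0..b})" for z
        using G_deriv by (auto simp: has_real_derivative_iff_has_vector_derivative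
            intro: has_vector_derivative_at_within)
    qed (rule g_cont)
    also have "\<dots> \<le> exp (- x) * (2 / sqrt (2 * x) * (pi / 2))"
      unfolding G_def using assms arctan_ubound[of "sqrt (2 * x) * sinh (b / 2)"]
      by (simp, intro divide_right_mono) auto
    finally show ?thesis by (simp add: field_simps)
  qed
  then show "\<forall>\<^sub>F b in at_top. (LBINT z:{0..b}. t z) \<le> pi / sqrt (2 * x) * exp (- x)"
    by (intro eventually_mono[OF eventually_ge_at_top[of 0]])
qed simp

text \<open>The mass sits within distance of order 1 / sqrt x from 0. With a = 1 / sqrt x \<le> 1
  one has cosh a \<le> 1 + e a^2, so x cosh a exceeds x by at most e, and the interval length
  supplies the factor 1 / sqrt x.\<close>

lemma bessel_moment_0_lower:
  assumes "\<bar>\<nu>\<bar> \<le> 1" "x \<ge> 1"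
  shows "exp (- exp 1) / sqrt x * exp (- x) \<le> bessel_moment \<nu> 0 x"
proof -
  define a where "a = 1 / sqrt x"
  have a: "0 < a" "a \<le> 1" "a\<^sup>2 = 1 / x" using assms by (auto simp: a_def power_divide)
  have "a\<^sup>2 * exp a \<le> a\<^sup>2 * exp 1" using a(2) by (intro mult_left_mono) auto
  then have "exp a - 1 - a \<le> a\<^sup>2 * exp 1" "exp (- a) - 1 - (- a) \<le> a\<^sup>2 * exp 1"
    using exp_minus_taylor1_bounds(2)[of a] exp_minus_taylor1_bounds(2)[of "- a"]
    unfolding abs_minus_cancel abs_of_pos[OF a(1)] power2_minus by linarith+
  then have "cosh a \<le> 1 + a\<^sup>2 * exp 1"
    by (simp add: cosh_field_def)
  then have "x * cosh a \<le> x * (1 + a\<^sup>2 * exp 1)"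
    using assms by (intro mult_left_mono) auto
  then have "- exp 1 + - x \<le> - x * cosh a"
    using a(3) assms by (simp add: distrib_left)
  then have "exp (- exp 1) * exp (- x) \<le> exp (- x * cosh a)"
    by (simp flip: exp_add)
  then have "a * (exp (- exp 1) * exp (- x)) \<le> a * exp (- x * cosh a)"
    using a by (intro mult_left_mono) auto
  also have "\<dots> \<le> bessel_moment \<nu> 0 x"
    using assms a by (intro bessel_moment_lower) auto
  finally show ?thesis by (simp add: a_def)
qed

section \<open>Log-convexity\<close>

text \<open>The integral of (cosh z - a)^2 against the weight of order 0 is nonnegative; a is chosen
  as the weighted mean of cosh, which minimises it.\<close>

lemma bessel_moment_cauchy_schwarz:
  assumes "\<bar>\<nu>\<bar> \<le> 1" "x > 0"
  shows "(bessel_moment \<nu> 1 x)\<^sup>2 \<le> bessel_moment \<nu> 0 x * bessel_moment \<nu> 2 x"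
proof -
  define t where "t = (\<lambda>k z. cosh z ^ k * (exp (- x * cosh z) * cosh (\<nu> * z)))"
  have int: "set_integrable lborel {0..} (t k)" for k
    unfolding t_def using assms by (intro bessel_moment_integrable)
  have M: "bessel_moment \<nu> k x = (LBINT z:{0..}. t k z)" for k
    by (simp add: bessel_moment_def t_def)
  define a where "a = bessel_moment \<nu> 1 x / bessel_moment \<nu> 0 x"
  have pos: "bessel_moment \<nu> 0 x > 0" using assms by (rule bessel_moment_pos)
  have "t 2 z - 2 * a * t 1 z + a\<^sup>2 * t 0 z = (cosh z - a)\<^sup>2 * t 0 z" for z
    by (simp add: t_def power2_eq_square algebra_simps)
  then have "0 \<le> (LBINT z:{0..}. t 2 z - 2 * a * t 1 z + a\<^sup>2 * t 0 z)"
    by (auto simp: set_lebesgue_integral_def t_def intro!: integral_nonneg_AE)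
  also have "\<dots> = bessel_moment \<nu> 2 x - 2 * a * bessel_moment \<nu> 1 x + a\<^sup>2 * bessel_moment \<nu> 0 x"
    unfolding M using int by (simp add: set_integral_add set_integral_diff)
  finally show ?thesis
    using pos by (simp add: a_def field_simps power2_eq_square)
qed

text \<open>The ratio is minus the logarithmic derivative of the moment of order 0, and the
  Cauchy-Schwarz inequality says that its own derivative is nonpositive.\<close>

lemma bessel_moment_ratio_antimono:
  assumes "\<bar>\<nu>\<bar> \<le> 1" "0 < a" "a \<le> b"
  shows "bessel_moment \<nu> 1 b / bessel_moment \<nu> 0 b \<le> bessel_moment \<nu> 1 a / bessel_moment \<nu> 0 a"
proof (rule DERIV_nonpos_imp_nonincreasing[OF assms(3)])
  fix x assume "a \<le> x" "x \<le> b"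
  then have x: "x > 0" using assms by simp
  let ?M = "\<lambda>k. bessel_moment \<nu> k x"
  have "((\<lambda>x. bessel_moment \<nu> 1 x / bessel_moment \<nu> 0 x) has_real_derivative
      (- ?M 2 * ?M 0 - ?M 1 * (- ?M 1)) / (?M 0 * ?M 0)) (at x)"
    using bessel_moment_deriv[OF assms(1) x, of 0] bessel_moment_deriv[OF assms(1) x, of 1]
      bessel_moment_pos[OF assms(1) x, of 0]
    by (intro DERIV_divide) (auto simp: numeral_2_eq_2)
  moreover have "(- ?M 2 * ?M 0 - ?M 1 * (- ?M 1)) / (?M 0 * ?M 0) \<le> 0"
    using bessel_moment_cauchy_schwarz[OF assms(1) x]
    by (intro divide_nonpos_nonneg) (auto simp: power2_eq_square mult.commute)
  ultimately show "\<exists>y. ((\<lambda>x. bessel_moment \<nu> 1 x / bessel_moment \<nu> 0 x) has_real_derivative y) (at x) \<and> y \<le> 0"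
    by blast
qed

section \<open>Decaying solutions of \<open>Y'' = s\<^sup>m Y\<close>\<close>

lemma antimono_bounded_tendsto_at_right:
  fixes f :: "real \<Rightarrow> real"
  assumes anti: "\<And>x y. a < x \<Longrightarrow> x < y \<Longrightarrow> f y \<le> f x"
    and bound: "\<And>x. a < x \<Longrightarrow> f x \<le> B"
  obtains L where "(f \<longlongrightarrow> L) (at_right a)"
proof
  have bdd: "bdd_above (f ` {a<..})" using bound by (intro bdd_aboveI2) auto
  show "(f \<longlongrightarrow> (SUP x\<in>{a<..}. f x)) (at_right a)"
  proof (rule increasing_tendsto)
    show "\<forall>\<^sub>F x in at_right a. f x \<le> (SUP x\<in>{a<..}. f x)"
      using eventually_at_right_less[of a] by eventually_elim (auto intro: cSUP_upper bdd)
    fix l assume "l < (SUP x\<in>{a<..}. f x)"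
    then obtain b where b: "b > a" "l < f b"
      using bdd by (subst (asm) less_cSUP_iff) auto
    have "\<forall>\<^sub>F x in at_right a. a < x \<and> x < b"
      using b by (auto simp: eventually_at_right)
    then show "\<forall>\<^sub>F x in at_right a. l < f x"
      by eventually_elim (use b anti in \<open>force intro: less_le_trans\<close>)
  qed
qed

text \<open>A limit preserves only weak inequalities; strictness at 0 is recovered by passing
  through the intermediate point y / 2.\<close>

lemma strict_antimono_on_extend_limit:
  fixes f :: "real \<Rightarrow> real"
  assumes anti: "\<And>x y. 0 < x \<Longrightarrow> x < y \<Longrightarrow> f y < f x"
    and lim: "(f \<longlongrightarrow> f 0) (at_right 0)"
  shows "strict_antimono_on {0..} f"
proof (rule monotone_onI)
  fix x y :: real assume "x \<in> {0..}" "y \<in> {0..}" "x < y"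
  show "f y < f x"
  proof (cases "x = 0")
    case True
    have "f (y / 2) \<le> f 0"
    proof (rule tendsto_lowerbound[OF lim])
      have "\<forall>\<^sub>F z in at_right 0. 0 < z \<and> z < y / 2"
        using True \<open>x < y\<close> by (auto simp: eventually_at_right intro!: exI[of _ "y / 2"])
      then show "\<forall>\<^sub>F z in at_right 0. f (y / 2) \<le> f z"
        by eventually_elim (rule less_imp_le, auto intro: anti)
    qed simp
    moreover have "f y < f (y / 2)" using True \<open>x < y\<close> by (intro anti) auto
    ultimately show ?thesis using True by simp
  qed (use anti \<open>x < y\<close> \<open>x \<in> {0..}\<close> in auto)
qed

text \<open>\<open>D\<close> stands for Y'. The assumptions concern s > 0 only, because the Bessel
  formula degenerates at 0; the limits there are derived in \<open>tendsto_at_0\<close>.\<close>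

locale decaying_solution =
  fixes m :: real and Y D :: "real \<Rightarrow> real"
  assumes m_nonneg: "m \<ge> 0"
    and Y_pos: "s > 0 \<Longrightarrow> Y s > 0"
    and Y_deriv: "s > 0 \<Longrightarrow> (Y has_real_derivative D s) (at s)"
    and D_deriv: "s > 0 \<Longrightarrow> (D has_real_derivative s powr m * Y s) (at s)"
    and Y_tendsto_0: "(Y \<longlongrightarrow> 0) at_top"
begin

section \<open>Signs, decay at infinity and the energy inequality\<close>

lemma D_strict_mono:
  assumes "0 < a" "a < b"
  shows "D a < D b"
proof (rule DERIV_pos_imp_increasing[OF assms(2)])
  fix s assume "a \<le> s"
  then have "s > 0" using assms by simp
  then show "\<exists>y. (D has_real_derivative y) (at s) \<and> y > 0"
    using D_deriv[of s] Y_pos[of s] by (intro exI[of _ "s powr m * Y s"]) simp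
qed

text \<open>Were \<open>D\<close> nonnegative at s, it would stay so by monotonicity, and
  \<open>Y\<close> could not fall below \<open>Y s\<close> > 0 on its way to 0.\<close>

lemma D_neg:
  assumes "s > 0"
  shows "D s < 0"
proof (rule ccontr)
  assume "\<not> D s < 0"
  then have D: "D x \<ge> 0" if "x \<ge> s" for x
    using D_strict_mono[OF assms, of x] that by (cases "x = s") auto
  have "Y s \<le> Y x" if "x \<ge> s" for x
  proof (rule DERIV_nonneg_imp_nondecreasing[OF that])
    fix y assume "s \<le> y"
    then show "\<exists>d. (Y has_real_derivative d) (at y) \<and> d \<ge> 0"
      using D[of y] Y_deriv[of y] assms by (intro exI[of _ "D y"]) simp
  qed
  then have "Y s \<le> 0"
    by (intro tendsto_lowerbound[OF Y_tendsto_0] eventually_mono[OF eventually_ge_at_top[of s]]) auto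
  then show False using Y_pos[OF assms] by simp
qed

lemma Y_strict_antimono:
  assumes "0 < a" "a < b"
  shows "Y b < Y a"
proof (rule DERIV_neg_imp_decreasing[OF assms(2)])
  fix s assume "a \<le> s"
  then show "\<exists>y. (Y has_real_derivative y) (at s) \<and> y < 0"
    using Y_deriv[of s] D_neg[of s] assms by (intro exI[of _ "D s"]) simp
qed

text \<open>By the mean value theorem on [s - 1, s] and the monotonicity of \<open>D\<close>, the
  negative number \<open>D s\<close> is at least \<open>Y s - Y (s - 1)\<close>, which tends to
  0.\<close>

lemma D_tendsto_0: "(D \<longlongrightarrow> 0) at_top"
proof (rule tendsto_sandwich)
  have "((\<lambda>s. Y (s - 1)) \<longlongrightarrow> 0) at_top"
    using filterlim_tendsto_add_at_top[OF tendsto_const[of "- 1"] filterlim_ident]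
    by (intro filterlim_compose[OF Y_tendsto_0]) simp
  then show "((\<lambda>s. Y s - Y (s - 1)) \<longlongrightarrow> 0) at_top"
    using Y_tendsto_0 by (auto intro: tendsto_eq_intros)
  have "Y s - Y (s - 1) \<le> D s" if "s > 1" for s
  proof -
    obtain \<xi> where "s - 1 < \<xi>" "\<xi> < s" "Y s - Y (s - 1) = (s - (s - 1)) * D \<xi>"
      using MVT2[of "s - 1" s Y D] Y_deriv \<open>s > 1\<close> by auto
    then show ?thesis using D_strict_mono[of \<xi> s] that by simp
  qed
  then show "\<forall>\<^sub>F s in at_top. Y s - Y (s - 1) \<le> D s"
    by (intro eventually_mono[OF eventually_gt_at_top[of 1]])
  show "\<forall>\<^sub>F s in at_top. D s \<le> 0"
    using D_neg by (intro eventually_mono[OF eventually_gt_at_top[of 0]]) (auto intro: less_imp_le)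
qed simp

text \<open>
  The energy \<open>D\<^sup>2 - s\<^sup>m Y\<^sup>2\<close> is nonincreasing.  If it became negative, it would stay
  below a negative constant, so \<open>D'\<close> would be bounded below by a positive constant,
  contradicting \<open>D < 0\<close>.
\<close>

lemma powr_mult_Y_le_abs_D:
  assumes "a > 0"
  shows "a powr (m / 2) * Y a \<le> \<bar>D a\<bar>"
proof (rule ccontr)
  define F where "F = (\<lambda>s. (D s)\<^sup>2 - s powr m * (Y s)\<^sup>2)"
  have sq: "s powr m * (Y s)\<^sup>2 = (s powr (m / 2) * Y s)\<^sup>2" for s
    by (simp add: power_mult_distrib power2_eq_square flip: powr_add)
  assume "\<not> ?thesis"
  then have "(D a)\<^sup>2 < (a powr (m / 2) * Y a)\<^sup>2"
    using abs_le_square_iff[of "a powr (m / 2) * Y a" "D a"] Y_pos[OF assms] by (simp add: abs_mult)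
  then have Fa: "F a < 0" by (simp add: F_def sq)
  \<comment> \<open>The two terms 2 s^m Y D cancel by the equation, so only the derivative of the
    weight s^m survives.\<close>
  have F_deriv: "(F has_real_derivative - (m * s powr (m - 1) * (Y s)\<^sup>2)) (at s)" if "s > 0" for s
    unfolding F_def using that
    by (auto intro!: derivative_eq_intros Y_deriv D_deriv simp: algebra_simps power2_eq_square)
  have F_le: "F s \<le> F a" if "s \<ge> a" for s
  proof (rule DERIV_nonpos_imp_nonincreasing[OF that])
    fix x assume "a \<le> x"
    then show "\<exists>y. (F has_real_derivative y) (at x) \<and> y \<le> 0"
      using F_deriv[of x] assms m_nonneg by (intro exI[of _ "- (m * x powr (m - 1) * (Y x)\<^sup>2)"]) simp
  qed
  define c where "c = sqrt (- F a)"
  have c: "c > 0" "c\<^sup>2 = - F a" using Fa by (auto simp: c_def)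
  \<comment> \<open>The energy bounds s^m Y^2 from below; for s \<ge> 1 another factor s^m \<ge> 1
    turns this into a bound for D' = s^m Y.\<close>
  have c_le: "c \<le> s powr m * Y s" if "s \<ge> a" "s \<ge> 1" for s
  proof (rule power2_le_imp_le)
    have "c\<^sup>2 \<le> s powr m * (Y s)\<^sup>2"
      using F_le[OF that(1)] c(2) zero_le_power2[of "D s"] unfolding F_def by linarith
    also have "\<dots> \<le> s powr m * (s powr m * (Y s)\<^sup>2)"
      using that m_nonneg ge_one_powr_ge_zero[of s m] mult_right_mono[of 1 "s powr m" "s powr m * (Y s)\<^sup>2"]
      by simp
    finally show "c\<^sup>2 \<le> (s powr m * Y s)\<^sup>2" by (simp add: power2_eq_square algebra_simps)
    show "0 \<le> s powr m * Y s" using Y_pos[of s] that by simp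
  qed
  define s0 where "s0 = max a 1"
  have s0: "s0 \<ge> a" "s0 \<ge> 1" by (auto simp: s0_def)
  \<comment> \<open>At this point a line of slope c starting from \<open>D s0\<close> at
    \<open>s0\<close> reaches 0, so \<open>D s1\<close> cannot be negative.\<close>
  define s1 where "s1 = s0 + - D s0 / c"
  have "s1 > s0" using D_neg[of s0] s0 c by (simp add: s1_def divide_neg_pos)
  then obtain \<xi> where \<xi>: "s0 < \<xi>" "\<xi> < s1" "D s1 - D s0 = (s1 - s0) * (\<xi> powr m * Y \<xi>)"
    using MVT2[of s0 s1 D "\<lambda>s. s powr m * Y s"] D_deriv s0 by auto
  have "(s1 - s0) * c \<le> D s1 - D s0"
    unfolding \<xi>(3) using \<xi> s0 c_le[of \<xi>] \<open>s1 > s0\<close> by (intro mult_left_mono) auto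
  moreover have "(s1 - s0) * c = - D s0" using c by (simp add: s1_def)
  ultimately show False using D_neg[of s1] \<open>s1 > s0\<close> s0 by simp
qed

section \<open>Limits at 0\<close>

lemma bounded_at_0:
  obtains B where "\<And>s. s > 0 \<Longrightarrow> Y s \<le> B" "\<And>s. s > 0 \<Longrightarrow> - D s \<le> B"
proof
  \<comment> \<open>On \<open>(0, 1]\<close> the derivative of \<open>Y\<^sup>2 + D\<^sup>2\<close> is at least \<open>-2 (Y\<^sup>2 + D\<^sup>2)\<close>, so \<open>g\<close> is nondecreasing there.\<close>
  define g where "g = (\<lambda>s. exp (2 * s) * ((Y s)\<^sup>2 + (D s)\<^sup>2))"
  have g_deriv: "(g has_real_derivative
      exp (2 * s) * (2 * (Y s)\<^sup>2 + 2 * (D s)\<^sup>2 + (1 + s powr m) * (2 * (Y s * D s)))) (at s)" if "s > 0" for s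
    unfolding g_def using that
    by (auto intro!: derivative_eq_intros Y_deriv D_deriv simp: algebra_simps power2_eq_square)
  \<comment> \<open>As m \<ge> 0, the factor 1 + s^m is at most 2 on (0, 1], and 2 |Y D| \<le> Y^2 +
    D^2 then bounds the mixed term by the square terms.\<close>
  have g_deriv_nonneg: "0 \<le> 2 * (Y s)\<^sup>2 + 2 * (D s)\<^sup>2 + (1 + s powr m) * (2 * (Y s * D s))"
    if "0 < s" "s \<le> 1" for s
  proof -
    have "s powr m \<le> 1" using that m_nonneg by (simp add: powr_le1)
    then have "\<bar>(1 + s powr m) * (2 * (Y s * D s))\<bar> \<le> 2 * \<bar>2 * (Y s * D s)\<bar>"
      unfolding abs_mult[of "1 + s powr m"] by (intro mult_right_mono) auto
    also have "\<bar>2 * (Y s * D s)\<bar> \<le> (Y s)\<^sup>2 + (D s)\<^sup>2"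
      using zero_le_power2[of "Y s - D s"] zero_le_power2[of "Y s + D s"]
      by (simp add: abs_le_iff power2_eq_square algebra_simps)
    finally show ?thesis by simp
  qed
  have E_le: "(Y s)\<^sup>2 + (D s)\<^sup>2 \<le> g 1" if "0 < s" "s \<le> 1" for s
  proof -
    have "(Y s)\<^sup>2 + (D s)\<^sup>2 \<le> g s"
      using that mult_right_mono[of 1 "exp (2 * s)" "(Y s)\<^sup>2 + (D s)\<^sup>2"] by (simp add: g_def)
    also have "\<dots> \<le> g 1"
    proof (rule DERIV_nonneg_imp_nondecreasing[OF that(2)])
      fix x assume x: "s \<le> x" "x \<le> 1"
      then have "x > 0" using that by simp
      then show "\<exists>y. (g has_real_derivative y) (at x) \<and> y \<ge> 0"
        using g_deriv[of x] g_deriv_nonneg[of x] x by (meson exp_ge_zero mult_nonneg_nonneg)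
    qed
    finally show ?thesis .
  qed
  define B where "B = sqrt (g 1)"
  have near_0: "Y s \<le> B" "- D s \<le> B" if "0 < s" "s \<le> 1" for s
  proof -
    have "(Y s)\<^sup>2 \<le> g 1" "(- D s)\<^sup>2 \<le> g 1"
      using E_le[OF that] zero_le_power2[of "Y s"] zero_le_power2[of "D s"]
      unfolding power2_minus by linarith+
    then show "Y s \<le> B" "- D s \<le> B" unfolding B_def by (simp_all add: real_le_rsqrt)
  qed
  show "Y s \<le> B" if "s > 0" for s
    using near_0(1)[of s] near_0(1)[of 1] Y_strict_antimono[of 1 s] that by (cases "s \<le> 1") auto
  show "- D s \<le> B" if "s > 0" for s
    using near_0(2)[of s] near_0(2)[of 1] D_strict_mono[of 1 s] that by (cases "s \<le> 1") auto
qed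

text \<open>\<open>Y\<close> and \<open>- D\<close> decrease and are bounded above, so both converge
  at 0. This makes the \<open>Lim\<close> in \<open>y_sol\<close> and \<open>y_deriv\<close> genuine
  limits.\<close>

lemma tendsto_at_0:
  obtains L L' where "(Y \<longlongrightarrow> L) (at_right 0)" "(D \<longlongrightarrow> L') (at_right 0)"
proof -
  obtain B where B: "\<And>s. s > 0 \<Longrightarrow> Y s \<le> B" "\<And>s. s > 0 \<Longrightarrow> - D s \<le> B"
    using bounded_at_0 by blast
  obtain L where L: "(Y \<longlongrightarrow> L) (at_right 0)"
    by (rule antimono_bounded_tendsto_at_right[of 0 Y B]) (use B Y_strict_antimono in \<open>auto intro: less_imp_le\<close>)
  obtain L' where L': "((\<lambda>s. - D s) \<longlongrightarrow> L') (at_right 0)"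
    by (rule antimono_bounded_tendsto_at_right[of 0 "\<lambda>s. - D s" B])
       (use B D_strict_mono in \<open>auto intro: less_imp_le\<close>)
  show thesis
    using that[OF L] tendsto_minus[OF L'] by simp
qed

end

section \<open>The normalised solution\<close>

lemma C0_pos:
  assumes "\<gamma> > 0"
  shows "C0 \<gamma> > 0"
  using assms by (simp add: C0_def Gamma_real_pos)

locale scaled_bessel =
  fixes m \<gamma> :: real
  assumes m_nonneg: "m \<ge> 0" and \<gamma>_eq: "\<gamma> = (m + 2) / 2"
begin

abbreviation \<nu> :: real where "\<nu> \<equiv> 1 / (2 * \<gamma>)"

abbreviation M :: "nat \<Rightarrow> real \<Rightarrow> real" where "M k s \<equiv> bessel_moment \<nu> k (s powr \<gamma> / \<gamma>)"

definition Y :: "real \<Rightarrow> real" where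
  "Y s = C0 \<gamma> * (s powr (1 / 2) * M 0 s)"

text \<open>Product and chain rule applied to \<open>Y\<close>; the inner derivative is s^(\<gamma>
  - 1) = s^(m/2).\<close>

definition D :: "real \<Rightarrow> real" where
  "D s = C0 \<gamma> * (s powr (- 1 / 2) / 2 * M 0 s - s powr (m / 2 + 1 / 2) * M 1 s)"

lemma \<gamma>_ge_1: "\<gamma> \<ge> 1"
  using m_nonneg by (simp add: \<gamma>_eq)

lemma \<nu>_bounds: "\<bar>\<nu>\<bar> \<le> 1 / 2" "\<bar>\<nu>\<bar> \<le> 1"
  using \<gamma>_ge_1 by (auto simp: field_simps)

lemma C0_gt_0: "C0 \<gamma> > 0"
  using \<gamma>_ge_1 by (simp add: C0_pos)

lemma M_pos:
  assumes "s > 0"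
  shows "M k s > 0"
  using assms \<gamma>_ge_1 \<nu>_bounds by (intro bessel_moment_pos) auto

lemma M_deriv:
  assumes "s > 0"
  shows "(M k has_real_derivative - (s powr (m / 2) * M (Suc k) s)) (at s)"
proof -
  have "((\<lambda>s. s powr \<gamma> / \<gamma>) has_real_derivative s powr (m / 2)) (at s)"
    using DERIV_cdivide[OF has_real_derivative_powr[OF assms, of \<gamma>], of \<gamma>] \<gamma>_ge_1
    by (simp add: \<gamma>_eq add_divide_distrib)
  from DERIV_chain2[OF bessel_moment_deriv this, of \<nu> k] show ?thesis
    using assms \<gamma>_ge_1 \<nu>_bounds by (simp add: mult.commute)
qed

lemma Y_pos:
  assumes "s > 0"
  shows "Y s > 0"
  using assms C0_gt_0 M_pos[OF assms] by (simp add: Y_def)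

lemma Y_deriv:
  assumes "s > 0"
  shows "(Y has_real_derivative D s) (at s)"
proof -
  have "(Y has_real_derivative C0 \<gamma> * (1 / 2 * s powr (1 / 2 - 1) * M 0 s
      + - (s powr (m / 2) * M (Suc 0) s) * s powr (1 / 2))) (at s)"
    unfolding Y_def
    by (rule DERIV_cmult[OF DERIV_mult[OF has_real_derivative_powr[OF assms] M_deriv[OF assms]]])
  then show ?thesis by (simp add: D_def powr_add ac_simps)
qed

section \<open>The differential equation for \<open>Y\<close>\<close>

text \<open>The Bessel equation at x = s^\<gamma> / \<gamma>, multiplied by \<gamma>^2. The order
  \<nu> = 1 / (2 \<gamma>) gives \<gamma>^2 \<nu>^2 = 1/4, which cancels the -1/4 from
  differentiating s^(1/2) twice.\<close>

lemma M_recurrence: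
  assumes "s > 0"
  shows "(s powr \<gamma>)\<^sup>2 * M 2 s = \<gamma> * s powr \<gamma> * M 1 s + ((s powr \<gamma>)\<^sup>2 + 1 / 4) * M 0 s"
proof -
  define x where "x = s powr \<gamma> / \<gamma>"
  have x: "x > 0" "s powr \<gamma> = \<gamma> * x" using assms \<gamma>_ge_1 by (auto simp: x_def)
  have "\<gamma>\<^sup>2 * (x\<^sup>2 * bessel_moment \<nu> 2 x)
      = \<gamma>\<^sup>2 * (x * bessel_moment \<nu> 1 x + (x\<^sup>2 + \<nu>\<^sup>2) * bessel_moment \<nu> 0 x)"
    using bessel_moment_recurrence[OF \<nu>_bounds(2) x(1)] by simp
  moreover have "\<gamma>\<^sup>2 * \<nu>\<^sup>2 = 1 / 4"
    using \<gamma>_ge_1 by (simp add: power_divide power2_eq_square)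
  ultimately show ?thesis
    unfolding x_def[symmetric] unfolding x(2) by algebra
qed

lemma D_deriv:
  assumes s: "s > 0"
  shows "(D has_real_derivative s powr m * Y s) (at s)"
proof -
  \<comment> \<open>In terms of u and v every power of s is a monomial, with negative exponents only
    in u; multiplying by u^3 clears the denominators, and the recurrence then eliminates the moments
    of order 1 and 2.\<close>
  define u v where "u = s powr (1 / 2)" and "v = s powr (m / 2)"
  have pos: "u > 0" "v > 0" using s by (auto simp: u_def v_def)
  have u2: "s = u\<^sup>2" using s by (simp add: u_def power2_eq_square flip: powr_add)
  have p: "s powr (- 1 / 2) = 1 / u" "s powr (- 1 / 2 - 1) = 1 / (u * s)"
    "s powr (m / 2 + 1 / 2) = v * u" "s powr (m / 2 + 1 / 2 - 1) = v * u / s"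
    "s powr m = v\<^sup>2" "s powr \<gamma> = v * u\<^sup>2"
  proof -
    show minus_half: "s powr (- 1 / 2) = 1 / u" using s by (simp add: u_def powr_minus_divide)
    show "s powr (- 1 / 2 - 1) = 1 / (u * s)"
      using s unfolding powr_diff minus_half by simp
    show vu: "s powr (m / 2 + 1 / 2) = v * u" by (simp add: u_def v_def powr_add)
    show "s powr (m / 2 + 1 / 2 - 1) = v * u / s" using s unfolding powr_diff vu by simp
    show "s powr m = v\<^sup>2" by (simp add: v_def power2_eq_square flip: powr_add)
    have "s powr \<gamma> = s powr (m / 2) * s powr 1"
      unfolding \<gamma>_eq add_divide_distrib powr_add[symmetric] by simp
    then show "s powr \<gamma> = v * u\<^sup>2" using s u2 by (simp add: v_def)
  qed
  have "(D has_real_derivative C0 \<gamma> *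
      ((- 1 / 2) * s powr (- 1 / 2 - 1) / 2 * M 0 s - s powr (- 1 / 2) / 2 * (s powr (m / 2) * M 1 s)
        - ((m / 2 + 1 / 2) * s powr (m / 2 + 1 / 2 - 1) * M 1 s
           - s powr (m / 2 + 1 / 2) * (s powr (m / 2) * M 2 s)))) (at s)"
  proof (rule DERIV_cong)
    show "(D has_real_derivative C0 \<gamma> *
        ((- 1 / 2 * s powr (- 1 / 2 - 1) / 2 * M 0 s
            + - (s powr (m / 2) * M (Suc 0) s) * (s powr (- 1 / 2) / 2))
          - ((m / 2 + 1 / 2) * s powr (m / 2 + 1 / 2 - 1) * M 1 s
            + - (s powr (m / 2) * M (Suc 1) s) * s powr (m / 2 + 1 / 2)))) (at s)"
      unfolding D_def
      by (intro DERIV_cmult DERIV_diff DERIV_mult DERIV_cdivide has_real_derivative_powr M_deriv s)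
  qed (simp add: numeral_2_eq_2 mult.commute)
  moreover have "(- 1 / 2) * s powr (- 1 / 2 - 1) / 2 * M 0 s - s powr (- 1 / 2) / 2 * (s powr (m / 2) * M 1 s)
        - ((m / 2 + 1 / 2) * s powr (m / 2 + 1 / 2 - 1) * M 1 s
           - s powr (m / 2 + 1 / 2) * (s powr (m / 2) * M 2 s))
      = s powr m * (s powr (1 / 2) * M 0 s)" (is "?L = ?R")
  proof -
    define M0 where "M0 = M 0 s"
    define M1 where "M1 = M 1 s"
    define M2 where "M2 = M 2 s"
    note M_def = M0_def M1_def M2_def
    have rec: "(v * u\<^sup>2)\<^sup>2 * M2 = \<gamma> * (v * u\<^sup>2) * M1 + ((v * u\<^sup>2)\<^sup>2 + 1 / 4) * M0"
      using M_recurrence[OF s] unfolding M_def[symmetric] unfolding p .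
    have "?L * u ^ 3 = - M0 / 4 - \<gamma> * (v * u\<^sup>2) * M1 + (v * u\<^sup>2)\<^sup>2 * M2"
      unfolding M_def[symmetric] unfolding p u_def[symmetric] v_def[symmetric] \<gamma>_eq
      unfolding u2 using pos by (simp add: field_simps power2_eq_square power3_eq_cube)
    also have "\<dots> = ?R * u ^ 3"
      unfolding rec M_def[symmetric] unfolding p u_def[symmetric]
      by (simp add: algebra_simps power2_eq_square power3_eq_cube)
    finally show ?thesis using pos by simp
  qed
  ultimately show ?thesis by (simp add: Y_def mult.left_commute)
qed

section \<open>Size of \<open>Y\<close> and of its derivative\<close>

text \<open>The asymptotic profile of \<open>Y\<close> up to a constant: the prefactor s^(1/2) times
  the Bessel decay s^(- \<gamma>/2) has exponent - m/4.\<close>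

definition W :: "real \<Rightarrow> real" where
  "W s = s powr (- (m / 4)) * exp (- (s powr \<gamma> / \<gamma>))"

lemma half_powr_div_sqrt:
  assumes "s > 0"
  shows "s powr (1 / 2) / sqrt (s powr \<gamma>) = s powr (- (m / 4))"
proof -
  have "sqrt (s powr \<gamma>) = s powr (\<gamma> / 2)"
    using assms by (simp add: powr_powr flip: powr_half_sqrt)
  then show ?thesis
    using assms by (simp add: \<gamma>_eq field_simps flip: powr_diff)
qed

lemma Y_upper:
  obtains A where "A > 0" "\<And>s. s > 0 \<Longrightarrow> Y s \<le> A * W s"
proof
  define A where "A = C0 \<gamma> * (pi / sqrt (2 / \<gamma>))"
  show "A > 0" using C0_gt_0 \<gamma>_ge_1 by (simp add: A_def)
  fix s :: real assume s: "s > 0"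
  have "Y s \<le> C0 \<gamma> * (s powr (1 / 2) * (pi / sqrt (2 * (s powr \<gamma> / \<gamma>)) * exp (- (s powr \<gamma> / \<gamma>))))"
    unfolding Y_def using s \<gamma>_ge_1 C0_gt_0 \<nu>_bounds
    by (intro mult_left_mono bessel_moment_0_upper) auto
  also have "sqrt (2 * (s powr \<gamma> / \<gamma>)) = sqrt (2 / \<gamma>) * sqrt (s powr \<gamma>)"
    by (simp flip: real_sqrt_mult)
  also have "C0 \<gamma> * (s powr (1 / 2) * (pi / (sqrt (2 / \<gamma>) * sqrt (s powr \<gamma>)) * exp (- (s powr \<gamma> / \<gamma>))))
      = A * W s"
    unfolding W_def A_def half_powr_div_sqrt[OF s, symmetric] by simp
  finally show "Y s \<le> A * W s" .
qed

text \<open>The condition s^\<gamma> \<ge> \<gamma> says that the Bessel argument is at least 1, as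
  \<open>bessel_moment_0_lower\<close> demands; it becomes the threshold T0 = \<gamma>.\<close>

lemma Y_lower:
  obtains B where "B > 0" "\<And>s. s > 0 \<Longrightarrow> s powr \<gamma> \<ge> \<gamma> \<Longrightarrow> B * W s \<le> Y s"
proof
  define B where "B = C0 \<gamma> * (exp (- exp 1) / sqrt (1 / \<gamma>))"
  show "B > 0" using C0_gt_0 \<gamma>_ge_1 by (simp add: B_def)
  fix s :: real assume s: "s > 0" "s powr \<gamma> \<ge> \<gamma>"
  have "B * W s = C0 \<gamma> * (s powr (1 / 2) *
      (exp (- exp 1) / (sqrt (1 / \<gamma>) * sqrt (s powr \<gamma>)) * exp (- (s powr \<gamma> / \<gamma>))))"
    unfolding W_def B_def half_powr_div_sqrt[OF s(1), symmetric] by simp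
  also have "sqrt (1 / \<gamma>) * sqrt (s powr \<gamma>) = sqrt (s powr \<gamma> / \<gamma>)"
    by (simp flip: real_sqrt_mult)
  also have "C0 \<gamma> * (s powr (1 / 2) *
      (exp (- exp 1) / sqrt (s powr \<gamma> / \<gamma>) * exp (- (s powr \<gamma> / \<gamma>)))) \<le> Y s"
    unfolding Y_def using s \<gamma>_ge_1 C0_gt_0 \<nu>_bounds
    by (intro mult_left_mono bessel_moment_0_lower) auto
  finally show "B * W s \<le> Y s" .
qed

lemma Y_tendsto_0: "(Y \<longlongrightarrow> 0) at_top"
proof -
  obtain A where A: "A > 0" "\<And>s. s > 0 \<Longrightarrow> Y s \<le> A * W s" using Y_upper by blast
  have "Y s \<le> A * exp (- (s / \<gamma>))" if "s \<ge> 1" for s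
  proof -
    have "s powr (- (m / 4)) \<le> s powr 0"
      using that m_nonneg by (intro powr_mono) auto
    moreover have "s powr 1 \<le> s powr \<gamma>" using that \<gamma>_ge_1 by (intro powr_mono)
    then have "exp (- (s powr \<gamma> / \<gamma>)) \<le> exp (- (s / \<gamma>))"
      using that \<gamma>_ge_1 by (simp add: divide_right_mono)
    ultimately have "W s \<le> 1 * exp (- (s / \<gamma>))"
      unfolding W_def using that by (intro mult_mono) auto
    then have "A * W s \<le> A * exp (- (s / \<gamma>))" using A(1) by simp
    then show ?thesis using A(2)[of s] that by simp
  qed
  then have "\<forall>\<^sub>F s in at_top. norm (Y s) \<le> A * exp (- (s / \<gamma>))"
    using Y_pos by (intro eventually_mono[OF eventually_ge_at_top[of 1]]) (force simp: abs_of_pos)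
  moreover have "((\<lambda>s. A * exp (- (s / \<gamma>))) \<longlongrightarrow> 0) at_top"
  proof -
    have "filterlim (\<lambda>s. 1 / \<gamma> * s) at_top at_top"
      using \<gamma>_ge_1 by (intro filterlim_tendsto_pos_mult_at_top[OF tendsto_const] filterlim_ident) auto
    then have "((\<lambda>s. exp (- (1 / \<gamma> * s))) \<longlongrightarrow> 0) at_top"
      by (intro filterlim_compose[OF exp_at_bot] filterlim_compose[OF filterlim_uminus_at_bot_at_top])
    then show ?thesis by (simp add: tendsto_mult_right_zero)
  qed
  ultimately show ?thesis by (rule Lim_null_comparison)
qed

sublocale decaying_solution m Y D
  by unfold_locales (use m_nonneg Y_pos Y_deriv D_deriv Y_tendsto_0 in auto)

lemma abs_D_upper:
  obtains R where "R > 0" "\<And>s. s \<ge> 1 \<Longrightarrow> \<bar>D s\<bar> \<le> R * (s powr (m / 2) * Y s)"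
proof
  define R where "R = bessel_moment \<nu> 1 (1 / \<gamma>) / bessel_moment \<nu> 0 (1 / \<gamma>)"
  show "R > 0" unfolding R_def using \<gamma>_ge_1 \<nu>_bounds by (intro divide_pos_pos bessel_moment_pos) auto
  fix s :: real assume s: "s \<ge> 1"
  have "M 1 s / M 0 s \<le> R"
    unfolding R_def using s \<gamma>_ge_1 \<nu>_bounds ge_one_powr_ge_zero[of s \<gamma>]
    by (intro bessel_moment_ratio_antimono divide_right_mono) auto
  then have "M 1 s \<le> R * M 0 s" using M_pos[of s 0] s by (simp add: field_simps)
  then have "s powr (m / 2) * s powr (1 / 2) * M 1 s \<le> s powr (m / 2) * s powr (1 / 2) * (R * M 0 s)"
    by (intro mult_left_mono) auto
  moreover have "0 \<le> s powr (- 1 / 2) / 2 * M 0 s" using M_pos[of s 0] s by simp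
  ultimately have "C0 \<gamma> * - (s powr (- 1 / 2) / 2 * M 0 s - s powr (m / 2 + 1 / 2) * M 1 s)
      \<le> C0 \<gamma> * (s powr (m / 2) * s powr (1 / 2) * (R * M 0 s))"
    using C0_gt_0 unfolding powr_add by (intro mult_left_mono) linarith+
  then have "- D s \<le> R * (s powr (m / 2) * Y s)"
    unfolding D_def Y_def by (simp only: ac_simps mult_minus_right)
  then show "\<bar>D s\<bar> \<le> R * (s powr (m / 2) * Y s)" using D_neg[of s] s by simp
qed

end

section \<open>Scaling\<close>

lemma tendsto_at_right_0_scale:
  fixes c :: real
  assumes "(f \<longlongrightarrow> L) (at_right 0)" "c > 0"
  shows "((\<lambda>t. f (c * t)) \<longlongrightarrow> L) (at_right 0)"
  using assms filtermap_times_pos_at_right[of c 0]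
    filterlim_filtermap[of f "nhds L" "(*) c" "at_right 0"] by simp

lemma filterlim_at_top_scale:
  fixes c :: real
  assumes "filterlim f F at_top" "c > 0"
  shows "filterlim (\<lambda>t. f (c * t)) F at_top"
  using assms by (intro filterlim_compose[OF assms(1)]
      filterlim_tendsto_pos_mult_at_top[OF tendsto_const _ filterlim_ident])

context scaled_bessel
begin

section \<open>Transfer to arbitrary lam\<close>

lemma y_formula_eq_Y: "y_formula m lam t = Y (lam powr (1 / \<gamma>) * t)"
  by (simp add: y_formula_def Let_def Y_def bessel_K_eq_moment mult.assoc flip: \<gamma>_eq)

lemma y_sol_eq_Y:
  assumes "t > 0"
  shows "y_sol m lam t = Y (lam powr (1 / \<gamma>) * t)"
  using assms by (simp add: y_sol_def y_formula_eq_Y)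

lemma y_sol_deriv:
  assumes "lam > 0" "t > 0"
  shows "(y_sol m lam has_real_derivative lam powr (1 / \<gamma>) * D (lam powr (1 / \<gamma>) * t)) (at t)"
proof (rule has_field_derivative_transform_within_open)
  have "((*) (lam powr (1 / \<gamma>)) has_real_derivative lam powr (1 / \<gamma>)) (at t)"
    using DERIV_cmult_Id[of "lam powr (1 / \<gamma>)"] by simp
  from DERIV_chain2[OF Y_deriv this]
  show "((\<lambda>t. Y (lam powr (1 / \<gamma>) * t)) has_real_derivative
      lam powr (1 / \<gamma>) * D (lam powr (1 / \<gamma>) * t)) (at t)"
    using assms by (simp add: mult.commute)
  \<comment> \<open>\<open>y_sol\<close> has a separate value at 0, so it is compared with the
    scaled \<open>Y\<close> on the open half-line.\<close>
  show "open {0::real<..}" by simp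
qed (use assms y_sol_eq_Y in auto)

lemma y_deriv_eq_D:
  assumes "lam > 0" "t > 0"
  shows "y_deriv m lam t = lam powr (1 / \<gamma>) * D (lam powr (1 / \<gamma>) * t)"
  using assms by (simp add: y_deriv_def DERIV_imp_deriv[OF y_sol_deriv])

lemma y_sol_tendsto_0:
  assumes "lam > 0"
  shows "(y_sol m lam \<longlongrightarrow> y_sol m lam 0) (at_right 0)"
proof -
  obtain L where "(Y \<longlongrightarrow> L) (at_right 0)" using tendsto_at_0 by blast
  then have L: "(y_formula m lam \<longlongrightarrow> L) (at_right 0)"
    unfolding y_formula_eq_Y[abs_def] using assms by (intro tendsto_at_right_0_scale) auto
  then have "y_sol m lam 0 = L" by (simp add: y_sol_def tendsto_Lim)
  moreover have "\<forall>\<^sub>F t in at_right 0. y_formula m lam t = y_sol m lam t"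
    using eventually_at_right_less[of 0] by eventually_elim (simp add: y_sol_def)
  ultimately show ?thesis using L filterlim_cong by fastforce
qed

lemma y_deriv_tendsto_0:
  assumes "lam > 0"
  shows "(y_deriv m lam \<longlongrightarrow> y_deriv m lam 0) (at_right 0)"
proof -
  obtain L' where "(D \<longlongrightarrow> L') (at_right 0)" using tendsto_at_0 by blast
  then have lim: "((\<lambda>t. lam powr (1 / \<gamma>) * D (lam powr (1 / \<gamma>) * t)) \<longlongrightarrow> lam powr (1 / \<gamma>) * L') (at_right 0)"
    using assms by (intro tendsto_mult_left tendsto_at_right_0_scale) auto
  \<comment> \<open>\<open>Lim\<close> in \<open>y_deriv\<close> is applied to
    \<open>deriv (y_sol m lam)\<close>, so the limit passes from the scaled \<open>D\<close> to
    \<open>y_deriv\<close> and from there to that function.\<close>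
  have ev1: "\<forall>\<^sub>F t in at_right 0. lam powr (1 / \<gamma>) * D (lam powr (1 / \<gamma>) * t) = y_deriv m lam t"
    using eventually_at_right_less[of 0] by eventually_elim (simp add: y_deriv_eq_D assms)
  have ev2: "\<forall>\<^sub>F t in at_right 0. y_deriv m lam t = deriv (y_sol m lam) t"
    using eventually_at_right_less[of 0] by eventually_elim (simp add: y_deriv_def)
  have "(y_deriv m lam \<longlongrightarrow> lam powr (1 / \<gamma>) * L') (at_right 0)"
    by (rule Lim_transform_eventually[OF lim ev1])
  moreover from Lim_transform_eventually[OF this ev2]
  have "y_deriv m lam 0 = lam powr (1 / \<gamma>) * L'"
    by (simp add: y_deriv_def tendsto_Lim)
  ultimately show ?thesis by simp
qed

lemma y_sol_strict_antimono:
  assumes "lam > 0"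
  shows "strict_antimono_on {0..} (y_sol m lam)"
proof (rule strict_antimono_on_extend_limit[OF _ y_sol_tendsto_0[OF assms]])
  show "y_sol m lam y < y_sol m lam x" if "0 < x" "x < y" for x y
    using that assms Y_strict_antimono[of "lam powr (1 / \<gamma>) * x" "lam powr (1 / \<gamma>) * y"]
    by (simp add: y_sol_eq_Y)
qed

lemma minus_y_deriv_strict_antimono:
  assumes "lam > 0"
  shows "strict_antimono_on {0..} (\<lambda>t. - y_deriv m lam t)"
proof (rule strict_antimono_on_extend_limit)
  show "- y_deriv m lam y < - y_deriv m lam x" if "0 < x" "x < y" for x y
    using that assms D_strict_mono[of "lam powr (1 / \<gamma>) * x" "lam powr (1 / \<gamma>) * y"]
    by (simp add: y_deriv_eq_D)
qed (intro tendsto_minus y_deriv_tendsto_0 assms)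

text \<open>The value at t = 0 is a limit of positive numbers, so strict monotonicity is used to
  place it above the positive value at t + 1.\<close>

lemma y_sol_pos:
  assumes "lam > 0" "t \<ge> 0"
  shows "y_sol m lam t > 0"
proof -
  have "0 < y_sol m lam (t + 1)" using assms by (simp add: y_sol_eq_Y Y_pos)
  also have "\<dots> < y_sol m lam t"
    using monotone_onD[OF y_sol_strict_antimono[OF assms(1)], of t "t + 1"] assms by simp
  finally show ?thesis .
qed

lemma y_sol_at_top:
  assumes "lam > 0"
  shows "(y_sol m lam \<longlongrightarrow> 0) at_top" "(y_deriv m lam \<longlongrightarrow> 0) at_top"
proof -
  have "((\<lambda>t. Y (lam powr (1 / \<gamma>) * t)) \<longlongrightarrow> 0) at_top"
    using assms by (intro filterlim_at_top_scale Y_tendsto_0) auto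
  moreover have "\<forall>\<^sub>F t in at_top. Y (lam powr (1 / \<gamma>) * t) = y_sol m lam t"
    using eventually_gt_at_top[of 0] by eventually_elim (simp add: y_sol_eq_Y)
  ultimately show "(y_sol m lam \<longlongrightarrow> 0) at_top" by (rule Lim_transform_eventually)
  have "((\<lambda>t. lam powr (1 / \<gamma>) * D (lam powr (1 / \<gamma>) * t)) \<longlongrightarrow> 0) at_top"
    using assms by (intro tendsto_mult_right_zero filterlim_at_top_scale D_tendsto_0) auto
  moreover have "\<forall>\<^sub>F t in at_top. lam powr (1 / \<gamma>) * D (lam powr (1 / \<gamma>) * t) = y_deriv m lam t"
    using eventually_gt_at_top[of 0] by eventually_elim (simp add: y_deriv_eq_D assms)
  ultimately show "(y_deriv m lam \<longlongrightarrow> 0) at_top" by (rule Lim_transform_eventually)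
qed

section \<open>The scaled estimates\<close>

text \<open>The last two identities supply the factor lam^(1/\<gamma>) of the chain rule; the
  exponents of lam are (1 + m/2) / \<gamma> = 1 and (1 + m/4) / \<gamma> = 1/2 + 1/(m + 2).\<close>

lemma scaled_powr:
  assumes "lam > 0" "t > 0" and "s = lam powr (1 / \<gamma>) * t"
  shows "s powr \<gamma> = lam * t powr \<gamma>"
    and "lam powr (1 / \<gamma>) * s powr (m / 2) = t powr (m / 2) * lam"
    and "lam powr (1 / \<gamma>) * s powr (m / 4) = lam powr (1 / 2 + 1 / (m + 2)) * t powr (m / 4)"
proof -
  show "s powr \<gamma> = lam * t powr \<gamma>"
    using assms \<gamma>_ge_1 by (simp add: powr_mult powr_powr)
  have m_eq: "m = 2 * \<gamma> - 2" using \<gamma>_eq by (simp add: field_simps)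
  have "1 / \<gamma> + 1 / \<gamma> * (m / 2) = 1"
    unfolding m_eq using \<gamma>_ge_1 by (simp add: field_simps)
  then show "lam powr (1 / \<gamma>) * s powr (m / 2) = t powr (m / 2) * lam"
    using assms by (simp add: powr_mult powr_powr mult.assoc[symmetric] flip: powr_add)
  have "1 / \<gamma> + 1 / \<gamma> * (m / 4) = 1 / 2 + 1 / (m + 2)"
    unfolding m_eq using \<gamma>_ge_1 by (simp add: field_simps)
  then show "lam powr (1 / \<gamma>) * s powr (m / 4) = lam powr (1 / 2 + 1 / (m + 2)) * t powr (m / 4)"
    using assms by (simp add: powr_mult powr_powr mult.assoc[symmetric] flip: powr_add)
qed

lemma Y_bounds:
  obtains C where "C > 1"
    "\<And>s. s > 0 \<Longrightarrow> s powr \<gamma> \<ge> \<gamma> \<Longrightarrow> inverse C * W s \<le> Y s \<and> Y s \<le> C * W s"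
proof -
  obtain A where A: "A > 0" "\<And>s. s > 0 \<Longrightarrow> Y s \<le> A * W s" using Y_upper by blast
  obtain B where B: "B > 0" "\<And>s. s > 0 \<Longrightarrow> s powr \<gamma> \<ge> \<gamma> \<Longrightarrow> B * W s \<le> Y s"
    using Y_lower by blast
  define C where "C = 1 + A + inverse B"
  have C: "C > 1" "A \<le> C" "inverse C \<le> B"
    using A(1) B(1) le_imp_inverse_le[of "inverse B" C] by (auto simp: C_def add_pos_pos)
  have W: "W s \<ge> 0" for s by (simp add: W_def)
  show thesis
  proof (rule that[OF C(1)])
    fix s :: real assume s: "s > 0" "s powr \<gamma> \<ge> \<gamma>"
    show "inverse C * W s \<le> Y s \<and> Y s \<le> C * W s"
      using A(2)[OF s(1)] B(2)[OF s] mult_right_mono[OF C(2) W[of s]] mult_right_mono[OF C(3) W[of s]]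
      by linarith
  qed
qed

text \<open>The energy inequality already gives the lower bound with constant 1; adding 1 to the
  upper constant makes a single constant exceed 1.\<close>

lemma abs_D_bounds:
  obtains C where "C > 1"
    "\<And>s. s \<ge> 1 \<Longrightarrow> inverse C * (s powr (m / 2) * Y s) \<le> \<bar>D s\<bar> \<and> \<bar>D s\<bar> \<le> C * (s powr (m / 2) * Y s)"
proof -
  obtain R where R: "R > 0" "\<And>s. s \<ge> 1 \<Longrightarrow> \<bar>D s\<bar> \<le> R * (s powr (m / 2) * Y s)"
    using abs_D_upper by blast
  show thesis
  proof (rule that[of "R + 1"])
    fix s :: real assume s: "s \<ge> 1"
    have nonneg: "0 \<le> s powr (m / 2) * Y s" using Y_pos[of s] s by simp
    have "inverse (R + 1) * (s powr (m / 2) * Y s) \<le> 1 * (s powr (m / 2) * Y s)"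
      using R(1) by (intro mult_right_mono nonneg) (simp add: field_simps)
    moreover have "R * (s powr (m / 2) * Y s) \<le> (R + 1) * (s powr (m / 2) * Y s)"
      by (intro mult_right_mono nonneg) simp
    ultimately show "inverse (R + 1) * (s powr (m / 2) * Y s) \<le> \<bar>D s\<bar> \<and>
        \<bar>D s\<bar> \<le> (R + 1) * (s powr (m / 2) * Y s)"
      using R(2)[OF s] powr_mult_Y_le_abs_D[of s] s by linarith
  qed (use R in simp)
qed

lemma y_sol_bounds:
  "\<exists>T0\<ge>1. \<exists>C>1. \<forall>lam>0. \<forall>t\<ge>0. lam * t powr \<gamma> \<ge> T0 \<longrightarrow>
        inverse C * (lam powr (1 / \<gamma>) * t) powr (- (m / 4))
            * exp (- ((lam powr (1 / \<gamma>) * t) powr \<gamma> / \<gamma>)) \<le> y_sol m lam t \<and>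
        y_sol m lam t \<le> C * (lam powr (1 / \<gamma>) * t) powr (- (m / 4))
            * exp (- ((lam powr (1 / \<gamma>) * t) powr \<gamma> / \<gamma>))"
proof -
  obtain C where C: "C > 1"
    "\<And>s. s > 0 \<Longrightarrow> s powr \<gamma> \<ge> \<gamma> \<Longrightarrow> inverse C * W s \<le> Y s \<and> Y s \<le> C * W s"
    using Y_bounds by blast
  show ?thesis
  \<comment> \<open>Since lam t^\<gamma> = s^\<gamma>, the threshold \<gamma> is exactly the
    hypothesis of \<open>Y_bounds\<close>.\<close>
  proof (rule exI[of _ \<gamma>], rule conjI[OF \<gamma>_ge_1], rule exI[of _ C], rule conjI[OF C(1)], intro allI impI)
    fix lam t :: real assume *: "lam > 0" "t \<ge> 0" "\<gamma> \<le> lam * t powr \<gamma>"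
    \<comment> \<open>At t = 0 the convention \<open>0 powr \<gamma> = 0\<close> violates the
      threshold.\<close>
    then have t: "t > 0" using \<gamma>_ge_1 by (cases "t = 0") auto
    define s where "s = lam powr (1 / \<gamma>) * t"
    have "s > 0" using * t by (simp add: s_def)
    moreover have "s powr \<gamma> \<ge> \<gamma>" using scaled_powr(1)[OF *(1) t s_def] * by simp
    ultimately show "inverse C * (lam powr (1 / \<gamma>) * t) powr (- (m / 4))
            * exp (- ((lam powr (1 / \<gamma>) * t) powr \<gamma> / \<gamma>)) \<le> y_sol m lam t \<and>
        y_sol m lam t \<le> C * (lam powr (1 / \<gamma>) * t) powr (- (m / 4))
            * exp (- ((lam powr (1 / \<gamma>) * t) powr \<gamma> / \<gamma>))"
      using C(2)[of s] unfolding y_sol_eq_Y[OF t] s_def[symmetric] W_def mult.assoc by blast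
  qed
qed

lemma y_deriv_bounds:
  "\<exists>C>1. \<forall>lam>0. \<forall>t\<ge>0. lam powr (1 / \<gamma>) * t \<ge> 1 \<longrightarrow>
        inverse C * t powr (m / 2) * lam * y_sol m lam t \<le> \<bar>y_deriv m lam t\<bar> \<and>
        \<bar>y_deriv m lam t\<bar> \<le> C * t powr (m / 2) * lam * y_sol m lam t"
proof -
  obtain C where C: "C > 1" "\<And>s. s \<ge> 1 \<Longrightarrow>
      inverse C * (s powr (m / 2) * Y s) \<le> \<bar>D s\<bar> \<and> \<bar>D s\<bar> \<le> C * (s powr (m / 2) * Y s)"
    using abs_D_bounds by blast
  show ?thesis
  proof (rule exI[of _ C], rule conjI[OF C(1)], intro allI impI)
    fix lam t :: real assume *: "lam > 0" "t \<ge> 0" "1 \<le> lam powr (1 / \<gamma>) * t"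
    then have t: "t > 0" by (cases "t = 0") auto
    define \<mu> where "\<mu> = lam powr (1 / \<gamma>)"
    have \<mu>: "\<mu> > 0" using * by (simp add: \<mu>_def)
    define s where "s = \<mu> * t"
    have s: "s \<ge> 1" using * by (simp add: s_def \<mu>_def)
    have key: "c * t powr (m / 2) * lam * y_sol m lam t = \<mu> * (c * (s powr (m / 2) * Y s))" for c
    proof -
      have "c * t powr (m / 2) * lam * y_sol m lam t = c * (t powr (m / 2) * lam) * Y s"
        by (simp add: y_sol_eq_Y[OF t] s_def \<mu>_def)
      also have "\<dots> = \<mu> * (c * (s powr (m / 2) * Y s))"
        unfolding scaled_powr(2)[OF *(1) t s_def[unfolded \<mu>_def], symmetric] by (simp add: \<mu>_def)
      finally show ?thesis .
    qed
    have "\<bar>y_deriv m lam t\<bar> = \<mu> * \<bar>D s\<bar>"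
      using \<mu> by (simp add: y_deriv_eq_D[OF *(1) t] abs_mult s_def \<mu>_def)
    then show "inverse C * t powr (m / 2) * lam * y_sol m lam t \<le> \<bar>y_deriv m lam t\<bar> \<and>
        \<bar>y_deriv m lam t\<bar> \<le> C * t powr (m / 2) * lam * y_sol m lam t"
      unfolding key using C(2)[OF s] \<mu> by simp
  qed
qed

text \<open>The bounds for \<open>Y\<close> are inserted into the comparison of |D| with s^(m/2) Y:
  the constants multiply and s^(m/2) s^(- m/4) = s^(m/4).\<close>

lemma y_deriv_exp_bounds:
  "\<exists>T1>1. \<exists>C>1. \<forall>lam>0. \<forall>t\<ge>0. lam powr (1 / \<gamma>) * t \<ge> T1 \<longrightarrow>
        inverse C * lam powr (1 / 2 + 1 / (m + 2)) * t powr (m / 4)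
            * exp (- ((lam powr (1 / \<gamma>) * t) powr \<gamma> / \<gamma>)) \<le> \<bar>y_deriv m lam t\<bar> \<and>
        \<bar>y_deriv m lam t\<bar> \<le> C * lam powr (1 / 2 + 1 / (m + 2)) * t powr (m / 4)
            * exp (- ((lam powr (1 / \<gamma>) * t) powr \<gamma> / \<gamma>))"
proof -
  obtain C where C: "C > 1"
    "\<And>s. s > 0 \<Longrightarrow> s powr \<gamma> \<ge> \<gamma> \<Longrightarrow> inverse C * W s \<le> Y s \<and> Y s \<le> C * W s"
    using Y_bounds by blast
  obtain C' where C': "C' > 1" "\<And>s. s \<ge> 1 \<Longrightarrow>
      inverse C' * (s powr (m / 2) * Y s) \<le> \<bar>D s\<bar> \<and> \<bar>D s\<bar> \<le> C' * (s powr (m / 2) * Y s)"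
    using abs_D_bounds by blast
  have T1: "\<gamma> + 1 > 1" using \<gamma>_ge_1 by simp
  have CC: "C' * C > 1" using C C' by (simp add: less_1_mult)
  show ?thesis
  \<comment> \<open>The threshold \<gamma> + 1 exceeds 1 strictly and ensures both s \<ge> 1 and
    s^\<gamma> \<ge> s \<ge> \<gamma>.\<close>
  proof (rule exI[of _ "\<gamma> + 1"], rule conjI[OF T1], rule exI[of _ "C' * C"], rule conjI[OF CC], intro allI impI)
    fix lam t :: real assume *: "lam > 0" "t \<ge> 0" "\<gamma> + 1 \<le> lam powr (1 / \<gamma>) * t"
    then have t: "t > 0" using \<gamma>_ge_1 by (cases "t = 0") auto
    define \<mu> where "\<mu> = lam powr (1 / \<gamma>)"
    have \<mu>: "\<mu> > 0" using * by (simp add: \<mu>_def)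
    define s where "s = \<mu> * t"
    have s: "s \<ge> \<gamma> + 1" using * by (simp add: s_def \<mu>_def)
    have s1: "s \<ge> 1" "s > 0" using s \<gamma>_ge_1 by auto
    have "s powr 1 \<le> s powr \<gamma>" using s1 \<gamma>_ge_1 by (intro powr_mono)
    then have s\<gamma>: "s powr \<gamma> \<ge> \<gamma>" using s s1 by simp
    define V where "V = s powr (m / 2) * W s"
    have V_eq: "V = s powr (m / 4) * exp (- (s powr \<gamma> / \<gamma>))"
    proof -
      have "s powr (m / 2) * s powr (- (m / 4)) = s powr (m / 4)"
        by (simp flip: powr_add)
      then show ?thesis by (simp add: V_def W_def mult.assoc[symmetric])
    qed
    have key: "c * lam powr (1 / 2 + 1 / (m + 2)) * t powr (m / 4)
        * exp (- ((lam powr (1 / \<gamma>) * t) powr \<gamma> / \<gamma>)) = \<mu> * (c * V)" for c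
    proof -
      have "c * lam powr (1 / 2 + 1 / (m + 2)) * t powr (m / 4)
          * exp (- ((lam powr (1 / \<gamma>) * t) powr \<gamma> / \<gamma>))
        = c * (lam powr (1 / 2 + 1 / (m + 2)) * t powr (m / 4)) * exp (- (s powr \<gamma> / \<gamma>))"
        unfolding s_def \<mu>_def by (simp only: mult.assoc)
      also have "\<dots> = \<mu> * (c * V)"
        unfolding scaled_powr(3)[OF *(1) t s_def[unfolded \<mu>_def], symmetric] V_eq by (simp add: \<mu>_def)
      finally show ?thesis .
    qed
    have Y: "inverse C * W s \<le> Y s" "Y s \<le> C * W s" using C(2)[OF s1(2) s\<gamma>] by auto
    have "inverse (C' * C) * V = inverse C' * (s powr (m / 2) * (inverse C * W s))"
      by (simp add: V_def)
    also have "\<dots> \<le> inverse C' * (s powr (m / 2) * Y s)"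
      using C'(1) by (intro mult_left_mono Y) auto
    also have "\<dots> \<le> \<bar>D s\<bar>" using C'(2)[OF s1(1)] by simp
    finally have lower: "inverse (C' * C) * V \<le> \<bar>D s\<bar>" .
    have "\<bar>D s\<bar> \<le> C' * (s powr (m / 2) * Y s)" using C'(2)[OF s1(1)] by simp
    also have "\<dots> \<le> C' * (s powr (m / 2) * (C * W s))"
      using C'(1) by (intro mult_left_mono Y) auto
    also have "\<dots> = C' * C * V" by (simp add: V_def)
    finally have upper: "\<bar>D s\<bar> \<le> C' * C * V" .
    have "\<bar>y_deriv m lam t\<bar> = \<mu> * \<bar>D s\<bar>"
      using \<mu> by (simp add: y_deriv_eq_D[OF *(1) t] abs_mult s_def \<mu>_def)
    then show "inverse (C' * C) * lam powr (1 / 2 + 1 / (m + 2)) * t powr (m / 4)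
            * exp (- ((lam powr (1 / \<gamma>) * t) powr \<gamma> / \<gamma>)) \<le> \<bar>y_deriv m lam t\<bar> \<and>
        \<bar>y_deriv m lam t\<bar> \<le> C' * C * lam powr (1 / 2 + 1 / (m + 2)) * t powr (m / 4)
            * exp (- ((lam powr (1 / \<gamma>) * t) powr \<gamma> / \<gamma>))"
      unfolding key using lower upper \<mu> by simp
  qed
qed

end

theorem lemma2p1:
  fixes m \<gamma> :: real
  assumes m: "m \<ge> 0"
    and \<gamma>: "\<gamma> = (m + 2) / 2"
  shows
    "(\<forall>lam>0.
        (\<forall>t\<ge>0. y_sol m lam t > 0) \<and>
        (\<forall>t>0. y_sol m lam differentiable (at t)) \<and>
        (y_sol m lam \<longlongrightarrow> y_sol m lam 0) (at_right 0) \<and>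
        (y_deriv m lam \<longlongrightarrow> y_deriv m lam 0) (at_right 0) \<and>
        strict_antimono_on {0..} (y_sol m lam) \<and>
        strict_antimono_on {0..} (\<lambda>t. - y_deriv m lam t) \<and>
        (y_deriv m lam \<longlongrightarrow> 0) at_top \<and>
        (y_sol m lam \<longlongrightarrow> 0) at_top)
     \<and>
     (\<exists>T0\<ge>1. \<exists>C>1. \<forall>lam>0. \<forall>t\<ge>0. lam * t powr \<gamma> \<ge> T0 \<longrightarrow>
        inverse C * (lam powr (1 / \<gamma>) * t) powr (- (m / 4))
            * exp (- ((lam powr (1 / \<gamma>) * t) powr \<gamma> / \<gamma>)) \<le> y_sol m lam t \<and>
        y_sol m lam t \<le> C * (lam powr (1 / \<gamma>) * t) powr (- (m / 4))
            * exp (- ((lam powr (1 / \<gamma>) * t) powr \<gamma> / \<gamma>)))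
     \<and>
     (\<exists>C>1. \<forall>lam>0. \<forall>t\<ge>0. lam powr (1 / \<gamma>) * t \<ge> 1 \<longrightarrow>
        inverse C * t powr (m / 2) * lam * y_sol m lam t \<le> \<bar>y_deriv m lam t\<bar> \<and>
        \<bar>y_deriv m lam t\<bar> \<le> C * t powr (m / 2) * lam * y_sol m lam t)
     \<and>
     (\<exists>T1>1. \<exists>C>1. \<forall>lam>0. \<forall>t\<ge>0. lam powr (1 / \<gamma>) * t \<ge> T1 \<longrightarrow>
        inverse C * lam powr (1 / 2 + 1 / (m + 2)) * t powr (m / 4)
            * exp (- ((lam powr (1 / \<gamma>) * t) powr \<gamma> / \<gamma>)) \<le> \<bar>y_deriv m lam t\<bar> \<and>
        \<bar>y_deriv m lam t\<bar> \<le> C * lam powr (1 / 2 + 1 / (m + 2)) * t powr (m / 4)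
            * exp (- ((lam powr (1 / \<gamma>) * t) powr \<gamma> / \<gamma>)))"
proof -
  interpret scaled_bessel m \<gamma> by unfold_locales (fact m, fact \<gamma>)
  have "y_sol m lam differentiable (at t)" if "lam > 0" "t > 0" for lam t
    using y_sol_deriv[OF that] by (auto simp: real_differentiable_def)
  then show ?thesis
    by (intro conjI allI impI y_sol_bounds y_deriv_bounds y_deriv_exp_bounds y_sol_pos y_sol_tendsto_0
        y_deriv_tendsto_0 y_sol_strict_antimono minus_y_deriv_strict_antimono y_sol_at_top)
qed

end
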